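(* Let $T\subset V$ be finite graphs such that $T$ is a rooted tree with root vertex $v_T$ and each vertex of $V$ has valence at least three. Let $\mathcal{E}$ be the set of edges of $T$ and $\mathcal{F}$ the frontier of $T$ in $V$, and fix $\mathbf{d}_{\mathcal{F}} = (d_e\,|\,e\in\mathcal{F})$ with positive entries. If $\mathrm{Ad}(\mathbf{d}_{\mathcal{F}})\neq \emptyset$, then for each $\mathbf{d}_{\mathcal{E}}$ in its closure $\overline{\mathrm{Ad}}(\mathbf{d}_{\mathcal{F}})$, $\mathbf{d} = (\mathbf{d}_{\mathcal{E}},\mathbf{d}_{\mathcal{F}})$ satisfies: (1) For $v\in T^{(0)}-\{v_T\}$ with valence $n_v$ in $V$, $P_v(\mathbf{d}) \in\widetilde{\mathcal{AC}}_{n_v} - \widetilde{\mathcal{C}}_{n_v}$ has largest entry $d_{e_v}$. (2) $P_{v_T}(\mathbf{d}) \in \widetilde{\mathcal{C}}_{n_T}\cup \widetilde{\mathcal{BC}}_{n_T}$, where $v_T$ has valence $n_T$ in $V$. (3) $J(P_{v}(\mathbf{d})) \geq J(P_w(\mathbf{d}))$ for each $v\in T^{(0)}$ and $w\in v- 1$, where $J(P_v(\mathbf{d}))$ and $J(P_w(\mathbf{d}))$ are the respective radii of $P_v(\mathbf{d})$ and $P_w(\mathbf{d})$.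
   Context: Cyclic polygons. A compact convex polygon in $\mathbb{H}^2$ is cyclic if its vertices are equidistant from a point (its center); the common distance is its radius. For $n\ge3$ let $\widetilde{\mathcal{AC}}_n=\{(d_0,\dots,d_{n-1})\in(\mathbb{R}^+)^n : \sinh(d_i/2)<\sum_{j\ne i}\sinh(d_j/2)\ \forall i\}$; its elements are exactly the cyclically ordered side length collections of cyclic $n$-gons, each unique up to isometry. $J(\mathbf d)$ denotes the radius of the polygon represented by $\mathbf d$. For $J\ge d/2>0$ let $A_d(J)\in(0,\pi]$ be given by $\sinh J\,\sin(A_d(J)/2)=\sinh(d/2)$ (apex angle of an isosceles triangle with two sides $J$ and base $d$). $\widetilde{\mathcal C}_n$ is the set of $\mathbf d\in(\mathbb{R}^+)^n$ with $\sum_{j}A_{d_j}(d_i/2)>2\pi$ where $d_i$ is a maximal entry; equivalently, the elements of $\widetilde{\mathcal{AC}}_n$ whose polygon has its center in its interior. $\widetilde{\mathcal{BC}}_n$ is the set with $\sum_{j}A_{d_j}(d_i/2)=2\pi$; equivalently, the elements of $\widetilde{\mathcal{AC}}_n$ whose polygon has its center at the midpoint of its longest side (radius $d_i/2$). Trees. At each vertex of $V$ a cyclic order on the edges of $V$ containing it is fixed. The frontier $\mathcal F$ of $T$ is the set of pairs $(e,v)$ with $e$ an edge of $V$ not in $T$ and $v\in e\cap T$; "$e\in\mathcal F$" means $(e,v)\in\mathcal F$ for some $v$. For $v\in T^{(0)}-\{v_T\}$, $e_v$ is the first edge of the path in $T$ from $v$ to $v_T$. For $v\in T^{(0)}$ let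 $v-1$ be the set of $w\in T^{(0)}-\{v_T\}$ such that $v$ is the endpoint of $e_w$ other than $w$. Given $\mathbf d_{\mathcal F}=(d_e\,|\,e\in\mathcal F)$ with $d_e>0$ and $\mathbf d_{\mathcal E}=(d_e\,|\,e\in\mathcal E)$, put $\mathbf d=(\mathbf d_{\mathcal E},\mathbf d_{\mathcal F})$ and $P_v(\mathbf d)=(d_{e_0},\dots,d_{e_{n-1}})$, where $e_0,\dots,e_{n-1}$ are the cyclically ordered edges of $V$ at $v$. $\mathrm{Ad}(\mathbf d_{\mathcal F})$ is the set of $\mathbf d_{\mathcal E}\in\mathbb{R}^{\mathcal E}$ such that: (i) for $v\in T^{(0)}-\{v_T\}$ of valence $n_v$ in $V$, $P_v(\mathbf d)\in\widetilde{\mathcal{AC}}_{n_v}-\widetilde{\mathcal C}_{n_v}$ has largest entry $d_{e_v}$; (ii) $P_{v_T}(\mathbf d)\in\widetilde{\mathcal C}_{n_T}$, $n_T$ the valence of $v_T$ in $V$; (iii) $J(P_v(\mathbf d))>J(P_w(\mathbf d))$ for each $v\in T^{(0)}$ and $w\in v-1$. $\overline{\mathrm{Ad}}(\mathbf d_{\mathcal F})$ is its closure in $\mathbb{R}^{\mathcal E}$. *)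

theory Defs
  imports "HOL-Analysis.Analysis"
begin

section \<open>Cyclic hyperbolic polygons\<close>

text \<open>
  The hyperbolic plane is the open unit disk in its Beltrami--Klein model (curvature -1).
  Geodesics are straight chords, so hyperbolic convexity, convex hulls and faces
  are the Euclidean ones.
\<close>

abbreviation hyp_plane :: "complex set"
  where "hyp_plane \<equiv> ball 0 1"

definition hyp_dist :: "complex \<Rightarrow> complex \<Rightarrow> real"
  where "hyp_dist x y = arcosh ((1 - x \<bullet> y) / sqrt ((1 - (norm x)\<^sup>2) * (1 - (norm y)\<^sup>2)))"

text \<open>
  A compact convex polygon is recorded by the list of its vertices in their cyclic order
  along the boundary (either direction, any starting point).
\<close>

definition convex_polygon :: "complex list \<Rightarrow> bool"
  where "convex_polygon ps \<longleftrightarrow>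
    length ps \<ge> 3 \<and> distinct ps \<and> set ps \<subseteq> hyp_plane \<and>
    {x. x extreme_point_of (convex hull (set ps))} = set ps \<and>
    (\<forall>i<length ps.
      closed_segment (ps ! i) (ps ! (Suc i mod length ps)) edge_of (convex hull (set ps)))"

definition side_lengths :: "complex list \<Rightarrow> real list"
  where "side_lengths ps =
    map (\<lambda>i. hyp_dist (ps ! i) (ps ! (Suc i mod length ps))) [0..<length ps]"

definition cyclic_polygon :: "complex list \<Rightarrow> real \<Rightarrow> bool"
  where "cyclic_polygon ps r \<longleftrightarrow>
    convex_polygon ps \<and> (\<exists>c\<in>hyp_plane. \<forall>p\<in>set ps. hyp_dist c p = r)"

text \<open>
  \<open>AC n\<close> consists of the cyclically ordered side lengths of the cyclic \<open>n\<close>-gons.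
\<close>

definition AC :: "nat \<Rightarrow> real list set"
  where "AC n = {d. length d = n \<and> (\<forall>i<n. 0 < d ! i) \<and>
    (\<forall>i<n. sinh (d ! i / 2) < (\<Sum>j\<in>{..<n} - {i}. sinh (d ! j / 2)))}"

text \<open>
  On \<^const>\<open>AC\<close> the radius exists and is unique, because a cyclic polygon with given side
  lengths exists and is unique up to isometry; elsewhere the value of \<open>J\<close> carries no meaning.
\<close>

definition J :: "real list \<Rightarrow> real"
  where "J d = (THE r. \<exists>ps. cyclic_polygon ps r \<and> side_lengths ps = d)"

text \<open>
  The apex angle in \<open>(0, \<pi>]\<close> of an isosceles triangle with base \<open>d\<close> and two sides \<open>r \<ge> d / 2\<close>.
\<close>

definition apex_angle :: "real \<Rightarrow> real \<Rightarrow> real"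
  where "apex_angle d r = (THE a. 0 < a \<and> a \<le> pi \<and> sinh r * sin (a / 2) = sinh (d / 2))"

lemma apex_angle_eq:
  assumes "0 < d" "d / 2 \<le> r"
  shows "apex_angle d r = 2 * arcsin (sinh (d / 2) / sinh r)"
proof -
  let ?q = "sinh (d / 2) / sinh r"
  have r: "0 < sinh r" using assms by simp
  have q: "0 < ?q" "?q \<le> 1" using assms r by (simp_all add: divide_le_eq_1)
  show ?thesis
    unfolding apex_angle_def
  proof (rule the_equality)
    have "0 < arcsin ?q" using q arcsin_less_mono[of 0 ?q] by simp
    then show "0 < 2 * arcsin ?q \<and> 2 * arcsin ?q \<le> pi \<and>
        sinh r * sin (2 * arcsin ?q / 2) = sinh (d / 2)"
      using q r arcsin_bounded[of ?q] by simp
  next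
    fix a assume a: "0 < a \<and> a \<le> pi \<and> sinh r * sin (a / 2) = sinh (d / 2)"
    then have "sin (a / 2) = ?q" using r by (simp add: field_simps)
    moreover have "arcsin (sin (a / 2)) = a / 2" using a by (intro arcsin_sin) auto
    ultimately show "a = 2 * arcsin ?q" by simp
  qed
qed

text \<open>
  At radius half the longest side, the apex angles over all sides add up to more than
  (\<open>Cent\<close>) or exactly (\<open>BC\<close>) \<open>2 \<pi>\<close>, the longest side contributing \<open>\<pi>\<close>:
  the polygon has its center in its interior, respectively at the midpoint of its longest side.
\<close>

definition Cent :: "nat \<Rightarrow> real list set"
  where "Cent n = {d. length d = n \<and> (\<forall>i<n. 0 < d ! i) \<and>
    (\<Sum>j<n. apex_angle (d ! j) (Max (set d) / 2)) > 2 * pi}"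

definition BC :: "nat \<Rightarrow> real list set"
  where "BC n = {d. length d = n \<and> (\<forall>i<n. 0 < d ! i) \<and>
    (\<Sum>j<n. apex_angle (d ! j) (Max (set d) / 2)) = 2 * pi}"


section \<open>Graphs and rooted trees\<close>

text \<open>
  Multiple edges and loops are allowed; a loop is an edge whose set of ends is a singleton.
\<close>

record ('v, 'e) multigraph =
  verts :: "'v set"
  edges :: "'e set"
  ends :: "'e \<Rightarrow> 'v set"

definition finite_graph :: "('v, 'e) multigraph \<Rightarrow> bool"
  where "finite_graph G \<longleftrightarrow> finite (verts G) \<and> finite (edges G) \<and>
    (\<forall>e\<in>edges G. ends G e \<subseteq> verts G \<and> (card (ends G e) = 1 \<or> card (ends G e) = 2))"

definition subgraph :: "('v, 'e) multigraph \<Rightarrow> ('v, 'e) multigraph \<Rightarrow> bool"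
  where "subgraph H G \<longleftrightarrow> verts H \<subseteq> verts G \<and> edges H \<subseteq> edges G \<and>
    (\<forall>e\<in>edges H. ends H e = ends G e)"

definition edge_mult :: "('v, 'e) multigraph \<Rightarrow> 'v \<Rightarrow> 'e \<Rightarrow> nat"
  where "edge_mult G v e =
    (if e \<in> edges G \<and> v \<in> ends G e then if ends G e = {v} then 2 else 1 else 0)"

definition valence :: "('v, 'e) multigraph \<Rightarrow> 'v \<Rightarrow> nat"
  where "valence G v = (\<Sum>e\<in>edges G. edge_mult G v e)"

text \<open>
  A cyclic order on the edges at a vertex is given by a list that starts at an arbitrary place;
  a loop is listed twice, once for each of its two ends, so that the list at \<open>v\<close> has
  length \<open>valence G v\<close>.  Everything below is invariant under rotating these lists.
\<close>

definition cyclic_edge_orders :: "('v, 'e) multigraph \<Rightarrow> ('v \<Rightarrow> 'e list) \<Rightarrow> bool"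
  where "cyclic_edge_orders G ord \<longleftrightarrow>
    (\<forall>v\<in>verts G. \<forall>e. count_list (ord v) e = edge_mult G v e)"

definition walk :: "('v, 'e) multigraph \<Rightarrow> 'v list \<Rightarrow> 'e list \<Rightarrow> bool"
  where "walk G vs es \<longleftrightarrow> length vs = Suc (length es) \<and> set vs \<subseteq> verts G \<and> set es \<subseteq> edges G \<and>
    (\<forall>i<length es. ends G (es ! i) = {vs ! i, vs ! Suc i})"

definition is_tree :: "('v, 'e) multigraph \<Rightarrow> bool"
  where "is_tree G \<longleftrightarrow> verts G \<noteq> {} \<and>
    (\<forall>u\<in>verts G. \<forall>v\<in>verts G. \<exists>vs es. walk G vs es \<and> hd vs = u \<and> last vs = v) \<and>
    \<not> (\<exists>vs es. walk G vs es \<and> es \<noteq> [] \<and> hd vs = last vs \<and> distinct es \<and> distinct (tl vs))"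

definition frontier_pairs :: "('v, 'e) multigraph \<Rightarrow> ('v, 'e) multigraph \<Rightarrow> ('e \<times> 'v) set"
  where "frontier_pairs V T = {(e, v). e \<in> edges V - edges T \<and> v \<in> ends V e \<inter> verts T}"

text \<open>The edge \<open>e\<^sub>v\<close>: the first edge of the (unique) path in \<open>T\<close> from \<open>v\<close> to the root.\<close>

definition root_edge :: "('v, 'e) multigraph \<Rightarrow> 'v \<Rightarrow> 'v \<Rightarrow> 'e"
  where "root_edge T vT v =
    (THE e. \<exists>vs es. walk T vs (e # es) \<and> distinct vs \<and> hd vs = v \<and> last vs = vT)"

text \<open>The set written \<open>v - 1\<close>.\<close>

definition children :: "('v, 'e) multigraph \<Rightarrow> 'v \<Rightarrow> 'v \<Rightarrow> 'v set"
  where "children T vT v = {w \<in> verts T - {vT}. w \<noteq> v \<and> ends T (root_edge T vT w) = {w, v}}"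

definition P :: "('v \<Rightarrow> 'e list) \<Rightarrow> ('e \<Rightarrow> real) \<Rightarrow> 'v \<Rightarrow> real list"
  where "P ord d v = map d (ord v)"

text \<open>
  The space of real tuples indexed by the edges of \<open>T\<close> consists of the functions that are
  \<^const>\<open>undefined\<close> outside \<open>edges T\<close>; it is the carrier of \<^term>\<open>powertop_real (edges T)\<close>.
  The tuple \<open>(d\<^sub>\<E>, d\<^sub>\<F>)\<close> is \<^term>\<open>override_on dF dE (edges T)\<close>, which agrees with
  \<open>dE\<close> on \<open>edges T\<close> and with \<open>dF\<close> elsewhere.
\<close>

definition Ad :: "('v, 'e) multigraph \<Rightarrow> ('v, 'e) multigraph \<Rightarrow> 'v \<Rightarrow> ('v \<Rightarrow> 'e list) \<Rightarrow>
    ('e \<Rightarrow> real) \<Rightarrow> ('e \<Rightarrow> real) set"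
  where "Ad V T vT ord dF = {dE \<in> edges T \<rightarrow>\<^sub>E UNIV.
    let d = override_on dF dE (edges T) in
      (\<forall>v\<in>verts T - {vT}. P ord d v \<in> AC (valence V v) - Cent (valence V v) \<and>
        d (root_edge T vT v) = Max (set (P ord d v))) \<and>
      P ord d vT \<in> Cent (valence V vT) \<and>
      (\<forall>v\<in>verts T. \<forall>w\<in>children T vT v. J (P ord d v) > J (P ord d w))}"

definition Ad_closure :: "('v, 'e) multigraph \<Rightarrow> ('v, 'e) multigraph \<Rightarrow> 'v \<Rightarrow> ('v \<Rightarrow> 'e list) \<Rightarrow>
    ('e \<Rightarrow> real) \<Rightarrow> ('e \<Rightarrow> real) set"
  where "Ad_closure V T vT ord dF = powertop_real (edges T) closure_of Ad V T vT ord dF"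

end

theory Submission
  imports Defs "HOL-Complex_Analysis.Great_Picard"
begin

text \<open>
  A cyclic polygon of radius \<open>r\<close> cuts the full angle at its center into central angles \<open>2 t\<^sub>i\<close>,
  so the \<open>t\<^sub>i > 0\<close> have sum \<open>\<pi>\<close> and \<open>sinh (d\<^sub>i / 2) = sinh r * sin t\<^sub>i\<close>; conversely such data determine
  a polygon, and \<open>r\<close> is determined by the side lengths.  In these terms a polygon is centered iff all
  \<open>t\<^sub>i < \<pi> / 2\<close>, and the relation passes to limits as long as the radii stay bounded
  and the limiting side lengths are positive.

  Along a sequence in \<open>Ad\<close> all radii are at most the radius at the root.  The latter is bounded
  since the root polygon is centered and one of its \<open>t\<^sub>i\<close> is at least \<open>\<pi> / n\<close>; this excludes
  that a non-centered polygon degenerates to infinite radius.  The limiting lengths are positive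
  because, away from the root, \<open>e\<^sub>v\<close> is at least as long as the other edges at \<open>v\<close>, and going
  outward one ends on the frontier.  Hence all polygons converge to cyclic polygons, and the
  non-strict forms of the defining conditions survive.
\<close>

section \<open>Half angles and radii\<close>

text \<open>The half angles \<open>t i\<close> are the data, rather than the apex angles of the
  definitions, because an apex angle in \<open>(0, pi]\<close> cannot tell \<open>t\<close> from
  \<open>pi - t\<close>: in terms of apex angles, polygons with exterior center satisfy another
  angle equation than centered ones. With \<open>0 < t i < pi\<close> the equation is the same in
  all cases, so a limit cannot leave it, and the kind of polygon is read off from the largest angle.

  No continuity of \<open>J\<close> is proved. Compactness gives a convergent subsequence of radii
  and angles; the limit is half-angle data for the limiting lengths, and as these determine the
  radius, the radii converge along the subsequence to \<open>J\<close> of the limit. The strict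
  inequalities of \<open>AC\<close> return since they follow from half-angle data alone, and lying
  outside \<open>Cent\<close> persists since \<open>Cent\<close> amounts to finitely many strict
  inequalities \<open>t i < pi / 2\<close>.

  The price is paid at \<open>J\<close>, which is defined through polygons in the disk: half-angle
  data must be realized by a polygon, and conversely the angles around the center must be recovered
  from the convexity of an arbitrary polygon, whose center may lie outside.\<close>

lemma arcsin_scaled_sin_mono:
  fixes c :: real
  assumes "0 \<le> c" "c < 1" "0 \<le> a" "a \<le> b" "b \<le> pi / 2"
  shows "arcsin (c * sin a) \<le> arcsin (c * sin b)"
proof (rule arcsin_le_arcsin)
  have "sin a \<le> sin b" using assms by (intro sin_monotone_2pi_le) auto
  then show "c * sin a \<le> c * sin b" using assms by (intro mult_left_mono) auto
  have "0 \<le> sin a" using assms by (intro sin_ge_zero) auto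
  then have "0 \<le> c * sin a" using assms by simp
  then show "-1 \<le> c * sin a" by linarith
  show "c * sin b \<le> 1" using assms mult_left_le[of "sin b" c] sin_le_one[of b] by linarith
qed

lemma arcsin_scaled_sin_pos:
  fixes c :: real
  assumes "0 < c" "c < 1" "0 < a" "a \<le> pi / 2"
  shows "0 < arcsin (c * sin a)" "arcsin (c * sin a) < a" "sin (arcsin (c * sin a)) = c * sin a"
proof -
  have s: "0 < sin a" using assms by (intro sin_gt_zero) auto
  have 1: "0 < c * sin a" using s assms by simp
  have 2: "c * sin a < sin a" using s assms by simp
  have 3: "sin a \<le> 1" by simp
  show "sin (arcsin (c * sin a)) = c * sin a" using 1 2 3 by (intro sin_arcsin) linarith+
  have "arcsin 0 < arcsin (c * sin a)" using 1 2 3 by (intro arcsin_less_arcsin) linarith+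
  then show "0 < arcsin (c * sin a)" by simp
  have "arcsin (c * sin a) < arcsin (sin a)" using 1 2 3 by (intro arcsin_less_arcsin) linarith+
  also have "\<dots> = a" using assms by (intro arcsin_sin) auto
  finally show "arcsin (c * sin a) < a" .
qed

text \<open>The summands \<open>x\<close>, \<open>y\<close> on the right are smaller than
  \<open>a\<close>, \<open>b\<close> because \<open>c < 1\<close>, so their cosines are larger. The
  addition formula for sine then gives \<open>c * sin (a + b) < sin (x + y)\<close>, and
  \<open>x + y\<close> stays in the range where \<open>arcsin\<close> inverts
  \<open>sin\<close>.\<close>

lemma arcsin_scaled_sin_subadd:
  fixes c :: real
  assumes "0 < c" "c < 1" "0 < a" "0 < b" "a + b \<le> pi / 2"
  shows "arcsin (c * sin (a + b)) < arcsin (c * sin a) + arcsin (c * sin b)"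
proof -
  define x y where "x = arcsin (c * sin a)" and "y = arcsin (c * sin b)"
  have x: "0 < x" "x < a" "sin x = c * sin a"
    using arcsin_scaled_sin_pos[of c a] assms by (auto simp: x_def)
  have y: "0 < y" "y < b" "sin y = c * sin b"
    using arcsin_scaled_sin_pos[of c b] assms by (auto simp: y_def)
  have cx: "cos a < cos x" using x assms by (intro cos_monotone_0_pi) auto
  have cy: "cos b < cos y" using y assms by (intro cos_monotone_0_pi) auto
  have sa: "0 < sin a" "0 < sin b" using assms by (auto intro!: sin_gt_zero)
  have "c * sin (a + b) = c * sin a * cos b + c * sin b * cos a"
    by (simp add: sin_add algebra_simps)
  also have "\<dots> < c * sin a * cos y + c * sin b * cos x"
    using cx cy sa assms by (intro add_strict_mono mult_strict_left_mono) auto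
  also have "\<dots> = sin (x + y)" by (simp add: sin_add x y)
  finally have *: "c * sin (a + b) < sin (x + y)" .
  have "0 \<le> sin (a + b)" using assms by (intro sin_ge_zero) auto
  then have "0 \<le> c * sin (a + b)" using assms by simp
  then have "arcsin (c * sin (a + b)) < arcsin (sin (x + y))"
    using * by (intro arcsin_less_arcsin) auto
  also have "\<dots> = x + y" using x y assms by (intro arcsin_sin) auto
  finally show ?thesis by (simp add: x_def y_def)
qed

text \<open>The bound is for some \<open>x\<close> below the sum, not for the sum itself, because
  \<open>sum t S\<close> may exceed \<open>pi / 2\<close>, where monotonicity is lost. Terms are
  peeled off \<open>x\<close> until a single one covers the rest.\<close>

lemma arcsin_scaled_sin_le_sum:
  fixes c :: real
  assumes "0 < c" "c < 1" "finite S" "\<And>j. j \<in> S \<Longrightarrow> 0 < t j \<and> t j \<le> pi / 2"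
    "0 \<le> x" "x \<le> pi / 2" "x \<le> sum t S"
  shows "arcsin (c * sin x) \<le> (\<Sum>j\<in>S. arcsin (c * sin (t j)))"
  using assms(3-)
proof (induction S arbitrary: x rule: finite_induct)
  case empty
  then show ?case by simp
next
  case (insert a S)
  have pos: "0 \<le> (\<Sum>j\<in>S. arcsin (c * sin (t j)))"
    using insert.prems arcsin_scaled_sin_pos(1) assms(1,2)
    by (intro sum_nonneg) (metis insertCI less_imp_le)
  have ta: "0 < t a" "t a \<le> pi / 2" using insert.prems by auto
  show ?case
  proof (cases "x \<le> t a")
    case True
    then have "arcsin (c * sin x) \<le> arcsin (c * sin (t a))"
      using insert.prems ta assms by (intro arcsin_scaled_sin_mono) auto
    then show ?thesis using insert pos by simp
  next
    case False
    have "arcsin (c * sin (t a + (x - t a))) < arcsin (c * sin (t a)) + arcsin (c * sin (x - t a))"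
      using False ta insert.prems assms by (intro arcsin_scaled_sin_subadd) auto
    moreover have "arcsin (c * sin (x - t a)) \<le> (\<Sum>j\<in>S. arcsin (c * sin (t j)))"
      using False ta insert.prems insert.hyps by (intro insert.IH) (fastforce|simp)+
    ultimately show ?thesis using insert by simp
  qed
qed

lemma arcsin_scaled_sin_less_sum:
  fixes c :: real
  assumes "0 < c" "c < 1" "finite S" "card S \<ge> 2" "\<And>j. j \<in> S \<Longrightarrow> 0 < t j \<and> t j \<le> pi / 2"
    "0 \<le> x" "x \<le> pi / 2" "x \<le> sum t S"
  shows "arcsin (c * sin x) < (\<Sum>j\<in>S. arcsin (c * sin (t j)))"
proof -
  obtain a where a: "a \<in> S" using assms(4) by fastforce
  define S' where "S' = S - {a}"
  have S: "S = insert a S'" "a \<notin> S'" "finite S'" using a assms(3) by (auto simp: S'_def)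
  have "S' \<noteq> {}" using assms(4) S by auto
  then have pos: "0 < (\<Sum>j\<in>S'. arcsin (c * sin (t j)))"
    using S assms(1,2,5) arcsin_scaled_sin_pos(1) by (intro sum_pos) auto
  have ta: "0 < t a" "t a \<le> pi / 2" using assms(5) a by auto
  show ?thesis
  proof (cases "x \<le> t a")
    case True
    then have "arcsin (c * sin x) \<le> arcsin (c * sin (t a))"
      using ta assms by (intro arcsin_scaled_sin_mono) auto
    then show ?thesis using S pos by simp
  next
    case False
    have "arcsin (c * sin (t a + (x - t a))) < arcsin (c * sin (t a)) + arcsin (c * sin (x - t a))"
      using False ta assms by (intro arcsin_scaled_sin_subadd) auto
    moreover have "arcsin (c * sin (x - t a)) \<le> (\<Sum>j\<in>S'. arcsin (c * sin (t j)))"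
      using False ta assms S by (intro arcsin_scaled_sin_le_sum) (fastforce|simp)+
    ultimately show ?thesis using S by simp
  qed
qed

section \<open>Half-angle data: uniqueness of the radius and the polygon inequalities\<close>

definition half_angles :: "real list \<Rightarrow> real \<Rightarrow> (nat \<Rightarrow> real) \<Rightarrow> bool"
  where "half_angles d r t \<longleftrightarrow> 0 < r \<and> (\<Sum>i<length d. t i) = pi \<and>
    (\<forall>i<length d. 0 < d ! i \<and> 0 < t i \<and> sinh (d ! i / 2) = sinh r * sin (t i))"

lemma half_anglesD:
  assumes "half_angles d r t"
  shows "0 < r" "(\<Sum>i<length d. t i) = pi"
    "\<And>i. i < length d \<Longrightarrow> 0 < d ! i" "\<And>i. i < length d \<Longrightarrow> 0 < t i"
    "\<And>i. i < length d \<Longrightarrow> sinh (d ! i / 2) = sinh r * sin (t i)"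
  using assms by (auto simp: half_angles_def)

lemma half_angles_sum_others:
  assumes "half_angles d r t" "i < length d"
  shows "(\<Sum>j\<in>{..<length d} - {i}. t j) = pi - t i"
  using half_anglesD(2)[OF assms(1)] sum.remove[of "{..<length d}" i t] assms(2) by simp

text \<open>A third positive angle must fit into the sum \<open>pi\<close>. The consequence used
  throughout is that at most one angle fails to be acute.\<close>

lemma half_angles_add_less:
  assumes "half_angles d r t" "length d \<ge> 3" "i < length d" "j < length d" "i \<noteq> j"
  shows "t i + t j < pi"
proof -
  have "\<exists>k<length d. k \<noteq> i \<and> k \<noteq> j"
  proof (rule ccontr)
    assume "\<not> ?thesis"
    then have "{..<length d} \<subseteq> {i, j}" by auto
    then have "card {..<length d} \<le> card {i, j}" by (intro card_mono) auto
    then show False using assms by (simp split: if_splits)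
  qed
  then obtain k where k: "k < length d" "k \<noteq> i" "k \<noteq> j" by auto
  have "sum t {i, j, k} \<le> sum t {..<length d}"
    using assms k half_anglesD(4)[OF assms(1)] by (intro sum_mono2) (auto intro: less_imp_le)
  moreover have "sum t {i, j, k} = t i + t j + t k" using assms k by auto
  ultimately show ?thesis using half_anglesD(2,4)[OF assms(1)] k by fastforce
qed

lemma half_angles_less_pi:
  assumes "half_angles d r t" "length d \<ge> 3" "i < length d"
  shows "t i < pi"
proof -
  obtain j where "j < length d" "j \<noteq> i" using assms(2)
    by (metis One_nat_def Suc_1 Suc_lessD less_Suc_eq numeral_3_eq_3 order_less_le_trans
        zero_less_Suc zero_neq_one)
  then show ?thesis using half_angles_add_less[of d r t i j] half_anglesD(4)[of d r t j] assms by auto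
qed

text \<open>Passing from \<open>r\<close> to \<open>r' > r\<close> shrinks all \<open>sin (t i)\<close> by the same factor \<open>c < 1\<close>.  If all angles of the
  larger circle are acute, each of them is smaller than before, and so is their sum.  If one is obtuse,
  strict subadditivity of \<open>\<lambda>x. arcsin (c * sin x)\<close> contradicts the angle sum.\<close>

lemma half_angles_radius_unique_aux:
  assumes n: "length d \<ge> 3" and t: "half_angles d r t" and u: "half_angles d r' u" and "r < r'"
  shows False
proof -
  define c where "c = sinh r / sinh r'"
  have R: "0 < sinh r" "0 < sinh r'" "sinh r < sinh r'"
    using half_anglesD(1)[OF t] \<open>r < r'\<close> by auto
  have c: "0 < c" "c < 1" using R by (auto simp: c_def)
  have su: "sin (u i) = c * sin (t i)" if "i < length d" for i
    using half_anglesD(5)[OF t that] half_anglesD(5)[OF u that] R by (simp add: c_def field_simps)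
  have tp: "0 < t i" "t i < pi" if "i < length d" for i
    using half_anglesD(4)[OF t that] half_angles_less_pi[OF t n that] by auto
  have up: "0 < u i" "u i < pi" if "i < length d" for i
    using half_anglesD(4)[OF u that] half_angles_less_pi[OF u n that] by auto
  \<comment> \<open>The representative of \<open>t i\<close> in \<open>(0, pi / 2]\<close> with the
    same sine; \<open>arcsin (c * sin x)\<close> is controlled only on that range.\<close>
  define m where "m i = (if t i \<le> pi / 2 then t i else pi - t i)" for i
  have m: "0 < m i" "m i \<le> pi / 2" "sin (m i) = sin (t i)" "m i \<le> t i" if "i < length d" for i
    using tp[OF that] by (auto simp: m_def)
  have u_small: "u i = arcsin (c * sin (m i))" if "i < length d" "u i \<le> pi / 2" for i
    using su[OF that(1)] up[OF that(1)] that m(3)[OF that(1)] arcsin_sin[of "u i"] by simp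
  show False
  proof (cases "\<forall>i<length d. u i \<le> pi / 2")
    case True
    have "(\<Sum>i<length d. u i) < (\<Sum>i<length d. t i)"
    proof (rule sum_strict_mono)
      show "{..<length d} \<noteq> {}" using n by (metis le_zero_eq lessThan_empty_iff zero_neq_numeral)
      fix i assume "i \<in> {..<length d}"
      then have i: "i < length d" by simp
      have "u i < m i"
        using u_small[OF i] True i arcsin_scaled_sin_pos(2)[OF c m(1,2)[OF i]] by simp
      then show "u i < t i" using m(4)[OF i] by simp
    qed simp
    then show False using half_anglesD(2)[OF t] half_anglesD(2)[OF u] by simp
  next
    case False
    then obtain k where k: "k < length d" "u k > pi / 2" by force
    let ?S = "{..<length d} - {k}"
    have uj: "u j \<le> pi / 2" if "j \<in> ?S" for j
      using half_angles_add_less[OF u n, of j k] that k by auto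
    have "pi - u k = (\<Sum>j\<in>?S. u j)" using half_angles_sum_others[OF u k(1)] by simp
    also have "\<dots> = (\<Sum>j\<in>?S. arcsin (c * sin (m j)))"
      using u_small uj by (intro sum.cong) auto
    also have "\<dots> > arcsin (c * sin (m k))"
    proof (rule arcsin_scaled_sin_less_sum[OF c])
      \<comment> \<open>If no other \<open>t j\<close> is obtuse, the sum is
        \<open>pi - t k\<close>, which is at least \<open>m k\<close>. Otherwise a single obtuse
        \<open>t j\<close> suffices: \<open>m j = pi - t j\<close> exceeds
        \<open>t k\<close>.\<close>
      show "m k \<le> sum m ?S"
      proof (cases "\<forall>j\<in>?S. t j \<le> pi / 2")
        case True
        then have "sum m ?S = sum t ?S" by (intro sum.cong) (auto simp: m_def)
        then show ?thesis using half_angles_sum_others[OF t k(1)] by (auto simp: m_def)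
      next
        case False
        then obtain j where j: "j \<in> ?S" "t j > pi / 2" by force
        then have "m j \<le> sum m ?S" using m(1) by (intro member_le_sum) (auto intro: less_imp_le)
        moreover have "m k \<le> m j"
          using half_angles_add_less[OF t n, of j k] j k m(4)[OF k(1)] by (auto simp: m_def)
        ultimately show ?thesis by simp
      qed
    qed (use k n m in \<open>auto intro: less_imp_le\<close>)
    finally have "arcsin (c * sin (m k)) < pi - u k" .
    moreover have "pi - u k = arcsin (sin (pi - u k))"
      using k up[OF k(1)] by (intro arcsin_sin[symmetric]) auto
    ultimately show False using su[OF k(1)] m(3)[OF k(1)] by simp
  qed
qed

lemma half_angles_radius_unique:
  assumes "length d \<ge> 3" "half_angles d r t" "half_angles d r' u"
  shows "r = r'"
  using half_angles_radius_unique_aux assms by (meson linorder_neqE_linordered_idom)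

text \<open>Since the other angles add up to \<open>pi - t i\<close>, the sine of \<open>t i\<close>
  is the sine of their sum, and sine is subadditive for sums within \<open>[0, pi]\<close>. That
  alone gives a weak inequality; strictness comes from splitting off one \<open>t j\<close> and
  using that the cosine of the positive sum of the remaining angles is below 1.\<close>

lemma half_angles_imp_AC:
  assumes t: "half_angles d r t" and n: "length d \<ge> 3"
  shows "d \<in> AC (length d)"
proof -
  have R: "0 < sinh r" using half_anglesD(1)[OF t] by simp
  have le: "sin (sum t S) \<le> (\<Sum>j\<in>S. sin (t j))" "0 \<le> (\<Sum>j\<in>S. sin (t j))" if "S \<subseteq> {..<length d}" for S
  proof -
    have "finite S" using that finite_subset by blast
    then have "sin (sum t S) \<le> (\<Sum>j\<in>S. sin (t j)) \<and> 0 \<le> (\<Sum>j\<in>S. sin (t j))"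
      using that
    proof (induction S rule: finite_induct)
      case (insert a S)
      have a: "0 < t a" "t a < pi"
        using insert.prems half_anglesD(4)[OF t] half_angles_less_pi[OF t n] by auto
      have "sum t S \<le> sum t {..<length d}"
        using insert.prems half_anglesD(4)[OF t] by (intro sum_mono2) (auto intro: less_imp_le)
      moreover have "0 \<le> sum t S"
        using insert.prems half_anglesD(4)[OF t] by (intro sum_nonneg) (auto intro: less_imp_le)
      ultimately have s: "0 \<le> sin (sum t S)"
        using half_anglesD(2)[OF t] by (intro sin_ge_zero) auto
      have "sin (t a) * cos (sum t S) \<le> sin (t a) * 1" "cos (t a) * sin (sum t S) \<le> 1 * sin (sum t S)"
        using s a sin_gt_zero[of "t a"] by (intro mult_left_mono mult_right_mono; simp)+
      then have "sin (t a + sum t S) \<le> sin (t a) + sin (sum t S)"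
        by (simp add: sin_add)
      then show ?case using insert a sin_gt_zero[of "t a"] by auto
    qed simp
    then show "sin (sum t S) \<le> (\<Sum>j\<in>S. sin (t j))" "0 \<le> (\<Sum>j\<in>S. sin (t j))" by auto
  qed
  have "sin (t i) < (\<Sum>j\<in>{..<length d} - {i}. sin (t j))" if i: "i < length d" for i
  proof -
    have "\<exists>j<length d. j \<noteq> i" using n
      by (metis One_nat_def Suc_1 Suc_lessD less_Suc_eq numeral_3_eq_3 order_less_le_trans
        zero_less_Suc zero_neq_one)
    then obtain j where j: "j < length d" "j \<noteq> i" by auto
    let ?S = "{..<length d} - {i} - {j}"
    have S: "(\<Sum>k\<in>?S. t k) = pi - t i - t j"
      using half_angles_sum_others[OF t i] sum.remove[of "{..<length d} - {i}" j t] j by simp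
    have tj: "0 < t j" "t j < pi" "0 < t i" "t i < pi"
      using half_anglesD(4)[OF t] half_angles_less_pi[OF t n] i j by auto
    have ij: "t i + t j < pi" using half_angles_add_less[OF t n] i j by auto
    have "sin (t i) = sin (t j + sum t ?S)" using S by simp
    also have "\<dots> = sin (t j) * cos (sum t ?S) + cos (t j) * sin (sum t ?S)" by (simp add: sin_add)
    also have "\<dots> < sin (t j) * 1 + 1 * sin (sum t ?S)"
    proof (rule add_less_le_mono)
      have "cos (sum t ?S) < cos 0" using S ij tj by (intro cos_monotone_0_pi) auto
      then show "sin (t j) * cos (sum t ?S) < sin (t j) * 1"
        using tj sin_gt_zero[of "t j"] by (intro mult_strict_left_mono) auto
      have "0 \<le> sin (sum t ?S)" using S ij tj by (intro sin_ge_zero) auto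
      then show "cos (t j) * sin (sum t ?S) \<le> 1 * sin (sum t ?S)" by (intro mult_right_mono) auto
    qed
    also have "\<dots> \<le> sin (t j) + (\<Sum>k\<in>?S. sin (t k))" using le(1)[of ?S] by auto
    also have "\<dots> = (\<Sum>j\<in>{..<length d} - {i}. sin (t j))"
      using sum.remove[of "{..<length d} - {i}" j "\<lambda>k. sin (t k)"] j by simp
    finally show ?thesis .
  qed
  then have *: "sinh r * sin (t i) < (\<Sum>j\<in>{..<length d} - {i}. sinh r * sin (t j))" if "i < length d" for i
    using that R by (simp add: sum_distrib_left[symmetric])
  show ?thesis
    unfolding AC_def mem_Collect_eq
  proof (intro conjI allI impI refl)
    fix i assume i: "i < length d"
    show "0 < d ! i" by (rule half_anglesD(3)[OF t i])
    have "(\<Sum>j\<in>{..<length d} - {i}. sinh (d ! j / 2)) = (\<Sum>j\<in>{..<length d} - {i}. sinh r * sin (t j))"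
      by (intro sum.cong refl half_anglesD(5)[OF t]) simp
    then show "sinh (d ! i / 2) < (\<Sum>j\<in>{..<length d} - {i}. sinh (d ! j / 2))"
      unfolding half_anglesD(5)[OF t i] using *[OF i] by simp
  qed
qed

section \<open>Recognizing \<open>Cent\<close> and \<open>BC\<close> from half angles, and existence
  of half angles\<close>

text \<open>For a longest side \<open>i\<close>, this is half the sum of the apex angles on the
  circle that has side \<open>i\<close> as a diameter, so side \<open>i\<close> itself contributes
  \<open>pi / 2\<close> and the threshold is \<open>pi\<close>.\<close>

definition diam_sum :: "real list \<Rightarrow> nat \<Rightarrow> real"
  where "diam_sum d i = (\<Sum>j<length d. arcsin (sinh (d ! j / 2) / sinh (d ! i / 2)))"

lemma apex_angle_sum:
  assumes "\<And>j. j < length d \<Longrightarrow> 0 < d ! j" "i < length d" "\<And>j. j < length d \<Longrightarrow> d ! j \<le> d ! i"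
  shows "(\<Sum>j<length d. apex_angle (d ! j) (Max (set d) / 2)) = 2 * diam_sum d i"
proof -
  have "Max (set d) = d ! i"
    using assms(2,3) by (intro Max_eqI) (auto simp: in_set_conv_nth)
  then show ?thesis
    using assms by (simp add: diam_sum_def sum_distrib_left apex_angle_eq)
qed

lemma Cent_iff:
  assumes "i < length d" "\<And>j. j < length d \<Longrightarrow> d ! j \<le> d ! i"
  shows "d \<in> Cent (length d) \<longleftrightarrow> (\<forall>j<length d. 0 < d ! j) \<and> pi < diam_sum d i"
  using apex_angle_sum[of d i] assms by (auto simp: Cent_def)

lemma BC_iff:
  assumes "i < length d" "\<And>j. j < length d \<Longrightarrow> d ! j \<le> d ! i"
  shows "d \<in> BC (length d) \<longleftrightarrow> (\<forall>j<length d. 0 < d ! j) \<and> pi = diam_sum d i"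
  using apex_angle_sum[of d i] assms by (auto simp: BC_def)

lemma ex_max_nth:
  fixes d :: "real list"
  assumes "d \<noteq> []"
  obtains i where "i < length d" "\<And>j. j < length d \<Longrightarrow> d ! j \<le> d ! i"
proof -
  have "Max (set d) \<in> set d" using assms by auto
  then obtain i where "i < length d" "d ! i = Max (set d)" by (metis in_set_conv_nth)
  then show ?thesis using that by (metis List.finite_set Max_ge nth_mem)
qed

context
  fixes d r t i
  assumes n: "length d \<ge> 3" and t: "half_angles d r t"
    and i: "i < length d" "\<And>j. j < length d \<Longrightarrow> d ! j \<le> d ! i"
begin

lemma half_angles_sin_pos: "j < length d \<Longrightarrow> 0 < sin (t j)"
  using half_anglesD(4)[OF t] half_angles_less_pi[OF t n] sin_gt_zero by blast

lemma half_angles_ratio: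
  "j < length d \<Longrightarrow> sinh (d ! j / 2) / sinh (d ! i / 2) = sin (t j) / sin (t i)"
  using half_anglesD(5)[OF t] i(1) half_anglesD(1)[OF t] by simp

lemma half_angles_sin_le: "j < length d \<Longrightarrow> sin (t j) \<le> sin (t i)"
proof -
  assume j: "j < length d"
  have "sinh (d ! j / 2) \<le> sinh (d ! i / 2)" using i(2)[OF j] by simp
  then have "sinh r * sin (t j) \<le> sinh r * sin (t i)"
    using half_anglesD(5)[OF t j] half_anglesD(5)[OF t i(1)] by simp
  then show ?thesis using half_anglesD(1)[OF t] by simp
qed

text \<open>Shrinking the circle until side \<open>i\<close> is a diameter divides every
  \<open>sin (t j)\<close> by \<open>sin (t i) < 1\<close>, which enlarges each of the acute
  angles.\<close>

lemma diam_sum_gt_pi: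
  assumes "\<And>j. j < length d \<Longrightarrow> t j < pi / 2"
  shows "pi < diam_sum d i"
proof -
  have "t j < arcsin (sin (t j) / sin (t i))" if j: "j < length d" for j
  proof -
    have "sin (t i) < sin (pi / 2)"
      using assms[OF i(1)] half_anglesD(4)[OF t i(1)] by (intro sin_monotone_2pi) auto
    then have lt: "sin (t j) < sin (t j) / sin (t i)"
      using half_angles_sin_pos[OF j] half_angles_sin_pos[OF i(1)] by (simp add: field_simps)
    have "t j = arcsin (sin (t j))"
      using assms[OF j] half_anglesD(4)[OF t j] by (intro arcsin_sin[symmetric]) auto
    also have "\<dots> < arcsin (sin (t j) / sin (t i))"
      using lt half_angles_sin_le[OF j] half_angles_sin_pos[OF i(1)]
      by (intro arcsin_less_arcsin) (auto simp: divide_le_eq_1)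
    finally show ?thesis .
  qed
  then have "(\<Sum>j<length d. t j) < (\<Sum>j<length d. arcsin (sin (t j) / sin (t i)))"
    using i(1) by (intro sum_strict_mono) auto
  then show ?thesis
    using half_anglesD(2)[OF t] half_angles_ratio by (simp add: diam_sum_def)
qed

lemma half_angles_obtuse_index:
  assumes k: "k < length d" "pi / 2 \<le> t k"
  shows "k = i"
proof (rule ccontr)
  assume "k \<noteq> i"
  then have "t i < pi - t k" using half_angles_add_less[OF t n i(1) k(1)] by simp
  then have "sin (t i) < sin (pi - t k)"
    using half_anglesD(4)[OF t i(1)] k by (intro sin_monotone_2pi) auto
  then show False using half_angles_sin_le[OF k(1)] by simp
qed

lemma half_angles_others_acute:
  assumes "pi / 2 \<le> t i" "j < length d" "j \<noteq> i"
  shows "t j < pi / 2"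
  using half_angles_add_less[OF t n i(1) assms(2)] assms by simp

lemma diam_sum_remove:
  "diam_sum d i = pi / 2 + (\<Sum>j\<in>{..<length d} - {i}. arcsin (sin (t j) / sin (t i)))"
proof -
  have "diam_sum d i = (\<Sum>j<length d. arcsin (sin (t j) / sin (t i)))"
    using half_angles_ratio by (simp add: diam_sum_def)
  then show ?thesis
    using sum.remove[of "{..<length d}" i "\<lambda>j. arcsin (sin (t j) / sin (t i))"] i(1)
      half_angles_sin_pos[OF i(1)] by simp
qed

lemma diam_sum_eq_pi:
  assumes "t i = pi / 2"
  shows "diam_sum d i = pi"
proof -
  have s1: "sin (t i) = 1" unfolding assms by (rule sin_pi_half)
  have "(\<Sum>j\<in>{..<length d} - {i}. arcsin (sin (t j) / sin (t i))) = (\<Sum>j\<in>{..<length d} - {i}. t j)"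
  proof (intro sum.cong refl)
    fix j assume "j \<in> {..<length d} - {i}"
    then have "0 < t j" "t j < pi / 2"
      using half_angles_others_acute[of j] assms half_anglesD(4)[OF t, of j] by auto
    then show "arcsin (sin (t j) / sin (t i)) = t j" using s1 arcsin_sin[of "t j"] by simp
  qed
  then show ?thesis
    using diam_sum_remove half_angles_sum_others[OF t i(1)] assms by simp
qed

text \<open>The mechanism is that of radius uniqueness. On the circle with diameter side
  \<open>i\<close> the other sides have half angles \<open>u j\<close> with
  \<open>t j = arcsin (c * sin (u j))\<close>, where \<open>c = sin (t i) < 1\<close>. If these
  \<open>u j\<close> reached \<open>pi / 2\<close> in total, strict subadditivity would make
  \<open>pi - t i\<close>, the sum of the \<open>t j\<close>, larger than \<open>arcsin c\<close>;
  but the two are equal.\<close>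

lemma diam_sum_less_pi:
  assumes "pi / 2 < t i"
  shows "diam_sum d i < pi"
proof (rule ccontr)
  assume "\<not> ?thesis"
  let ?S = "{..<length d} - {i}"
  define c where "c = sin (t i)"
  define u where "u j = arcsin (sin (t j) / c)" for j
  have ti: "t i < pi" by (rule half_angles_less_pi[OF t n i(1)])
  have c: "0 < c" "c < 1"
  proof -
    show "0 < c" using half_angles_sin_pos[OF i(1)] by (simp add: c_def)
    have "sin (pi - t i) < sin (pi / 2)"
      using assms ti by (intro sin_monotone_2pi) auto
    then show "c < 1" by (simp add: c_def)
  qed
  have q: "0 < sin (t j) / c" "sin (t j) / c \<le> 1" if "j < length d" for j
    using half_angles_sin_pos[OF that] half_angles_sin_le[OF that] c by (auto simp: c_def)
  have cu: "arcsin (c * sin (u j)) = t j" if "j \<in> ?S" for j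
  proof -
    have "sin (u j) = sin (t j) / c" unfolding u_def using q[of j] that by (intro sin_arcsin) auto
    then have "c * sin (u j) = sin (t j)" using c by simp
    then show ?thesis
      using half_angles_others_acute[of j] that assms half_anglesD(4)[OF t, of j]
      by (auto intro!: arcsin_sin)
  qed
  have "arcsin (c * sin (pi / 2)) < (\<Sum>j\<in>?S. arcsin (c * sin (u j)))"
  proof (rule arcsin_scaled_sin_less_sum[OF c])
    show "pi / 2 \<le> sum u ?S"
      using \<open>\<not> diam_sum d i < pi\<close> diam_sum_remove by (simp add: u_def c_def)
    fix j assume "j \<in> ?S"
    then have j: "0 < sin (t j) / c" "sin (t j) / c \<le> 1" using q[of j] by auto
    then have "arcsin 0 < u j" "u j \<le> pi / 2" unfolding u_def
      by (intro arcsin_less_arcsin arcsin_ubound; linarith)+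
    then show "0 < u j \<and> u j \<le> pi / 2" by simp
  qed (use n i in auto)
  also have "\<dots> = pi - t i" using cu half_angles_sum_others[OF t i(1)] by simp
  also have "\<dots> = arcsin (sin (pi - t i))"
    using assms ti by (intro arcsin_sin[symmetric]) auto
  finally show False by (simp add: c_def)
qed

lemma half_angles_Cent_iff_max: "d \<in> Cent (length d) \<longleftrightarrow> (\<forall>j<length d. t j < pi / 2)"
proof -
  have "diam_sum d i \<le> pi" if "k < length d" "pi / 2 \<le> t k" for k
    using half_angles_obtuse_index[OF that] that diam_sum_eq_pi diam_sum_less_pi by force
  then show ?thesis
    using Cent_iff[OF i] diam_sum_gt_pi half_anglesD(3)[OF t] by (meson linorder_not_less)
qed

lemma half_angles_Cent_BC_max:
  assumes "\<And>j. j < length d \<Longrightarrow> t j \<le> pi / 2"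
  shows "d \<in> Cent (length d) \<union> BC (length d)"
proof (cases "\<forall>j<length d. t j < pi / 2")
  case False
  then have "t i = pi / 2"
    using assms half_angles_obtuse_index i(1) by (metis linorder_not_less order_antisym)
  then show ?thesis using BC_iff[OF i] diam_sum_eq_pi half_anglesD(3)[OF t] by auto
qed (use half_angles_Cent_iff_max in auto)

end

lemma half_angles_Cent_iff:
  assumes "length d \<ge> 3" "half_angles d r t"
  shows "d \<in> Cent (length d) \<longleftrightarrow> (\<forall>j<length d. t j < pi / 2)"
proof -
  have "d \<noteq> []" using assms by auto
  then obtain i where "i < length d" "\<And>j. j < length d \<Longrightarrow> d ! j \<le> d ! i"
    by (metis ex_max_nth)
  then show ?thesis using half_angles_Cent_iff_max assms by blast
qed

lemma half_angles_Cent_BC: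
  assumes "length d \<ge> 3" "half_angles d r t" "\<And>j. j < length d \<Longrightarrow> t j \<le> pi / 2"
  shows "d \<in> Cent (length d) \<union> BC (length d)"
proof -
  have "d \<noteq> []" using assms by auto
  then obtain i where "i < length d" "\<And>j. j < length d \<Longrightarrow> d ! j \<le> d ! i"
    by (metis ex_max_nth)
  then show ?thesis using half_angles_Cent_BC_max assms by blast
qed

text \<open>The intermediate value theorem is applied in the variable \<open>x = 1 / sinh r\<close>.\<close>

lemma half_angles_exist:
  assumes n: "length d \<ge> 3" and d: "d \<in> AC (length d) \<union> Cent (length d)"
  shows "\<exists>r t. half_angles d r t"
proof -
  have "d \<noteq> []" using n by auto
  then obtain i where i: "i < length d" "\<And>j. j < length d \<Longrightarrow> d ! j \<le> d ! i"
    by (metis ex_max_nth)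
  define s where "s j = sinh (d ! j / 2)" for j
  have pos: "0 < d ! j" if "j < length d" for j using d that by (auto simp: AC_def Cent_def)
  have s: "0 < s j" "s j \<le> s i" if "j < length d" for j
    using pos[OF that] i(2)[OF that] by (auto simp: s_def)
  let ?A = "\<lambda>x j. arcsin (s j * x)"
  let ?I = "{0..1 / s i}"
  have bd: "0 \<le> s j * x" "s j * x \<le> 1" if "j < length d" "x \<in> ?I" for j x
  proof -
    have "s j * x \<le> s i * x" using s that by (intro mult_right_mono) auto
    also have "\<dots> \<le> 1" using that s[OF i(1)] by (simp add: field_simps)
    finally show "s j * x \<le> 1" .
    show "0 \<le> s j * x" using s that by (intro mult_nonneg_nonneg) (auto intro: less_imp_le)
  qed
  have cont: "continuous_on ?I (\<lambda>x. ?A x j)" if "j < length d" for j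
    by (intro continuous_intros ballI) (use bd[OF that] in \<open>auto intro: order_trans[of _ 0]\<close>)
  have half: "half_angles d (arsinh (1 / x)) t"
    if x: "0 < x" "x \<in> ?I" and t: "\<And>j. j < length d \<Longrightarrow> t j = ?A x j \<or> t j = pi - ?A x j"
      and "(\<Sum>j<length d. t j) = pi" for x t
    unfolding half_angles_def
  proof (intro conjI allI impI)
    show "0 < arsinh (1 / x)" using x by simp
    fix j assume j: "j < length d"
    have "arcsin 0 < ?A x j"
      using bd[OF j x(2)] s[OF j] x by (intro arcsin_less_arcsin) auto
    then show "0 < t j" using t[OF j] arcsin_ubound[of "s j * x"] bd[OF j x(2)] pi_gt_zero
      by (smt (verit) arcsin_0 field_sum_of_halves)
    have "sin (t j) = sin (?A x j)" using t[OF j] by auto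
    also have "\<dots> = s j * x" using bd[OF j x(2)] by (intro sin_arcsin) auto
    finally show "sinh (d ! j / 2) = sinh (arsinh (1 / x)) * sin (t j)"
      using x by (simp add: s_def)
  qed (use that pos in auto)
  have s0: "0 < s i" using s i by auto
  have ds: "diam_sum d i = (\<Sum>j<length d. ?A (1 / s i) j)" by (simp add: diam_sum_def s_def)
  show ?thesis
  proof (cases "pi \<le> diam_sum d i")
    case True
    have "\<exists>x\<ge>0. x \<le> 1 / s i \<and> (\<Sum>j<length d. ?A x j) = pi"
      using True s0 by (intro IVT' continuous_on_sum) (auto intro: cont simp: ds)
    then obtain x where x: "0 \<le> x" "x \<le> 1 / s i" "(\<Sum>j<length d. ?A x j) = pi" by auto
    then have "x \<noteq> 0" by auto
    then have "half_angles d (arsinh (1 / x)) (?A x)" using x by (intro half) auto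
    then show ?thesis by blast
  next
    case False
    let ?S = "{..<length d} - {i}"
    have "d \<in> AC (length d)" using d False Cent_iff[OF i] by auto
    then have AC: "s i < sum s ?S" using i(1) by (auto simp: AC_def s_def)
    \<comment> \<open>\<open>G x = 0\<close> is the angle sum equation in which the longest side
      takes the angle \<open>pi - ?A x i\<close>. At \<open>x = 1 / s i\<close>, where that angle is
      \<open>pi / 2\<close>, the failure of \<open>pi \<le> diam_sum d i\<close> gives the
      sign.\<close>
    define G where "G x = (\<Sum>j\<in>?S. ?A x j) - ?A x i" for x
    have G1: "G (1 / s i) \<le> 0"
    proof -
      have "diam_sum d i = pi / 2 + (\<Sum>j\<in>?S. ?A (1 / s i) j)"
        unfolding ds using sum.remove[of "{..<length d}" i "?A (1 / s i)"] i(1) s0 by simp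
      then show ?thesis using False s0 by (simp add: G_def)
    qed
    \<comment> \<open>\<open>x = 0\<close>, the infinite radius, is a spurious zero of
      \<open>G\<close>, so the interval must start at a positive \<open>x0\<close>. To first order
      \<open>G x\<close> is \<open>x * (sum s ?S - s i)\<close>, positive by the \<open>AC\<close>
      inequality. To make this quantitative, \<open>h\<close> is the angle of the longest side at
      \<open>x0\<close>, chosen so small that \<open>sin h / h\<close> exceeds the ratio
      \<open>q < 1\<close>.\<close>
    define q where "q = s i / sum s ?S"
    have q: "0 < q" "q < 1" using AC s0 by (auto simp: q_def)
    obtain h where h: "0 < h" "h < pi / 2" "q * h < sin h"
    proof -
      have "((\<lambda>h. (sin (0 + h) - sin 0) / h) \<longlongrightarrow> cos (0::real)) (at 0)"
        using DERIV_sin[of "0::real"] unfolding DERIV_def .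
      then have "((\<lambda>h. sin h / h) \<longlongrightarrow> (1::real)) (at_right 0)"
        by (simp add: filterlim_at_split)
      then have "\<forall>\<^sub>F h in at_right 0. q < sin h / h" using q(2) by (rule order_tendstoD)
      moreover have "\<forall>\<^sub>F h in at_right 0. h \<in> {0<..<pi/2}"
        by (rule eventually_at_right_real) simp
      ultimately have "\<forall>\<^sub>F h in at_right 0. h \<in> {0<..<pi/2} \<and> q < sin h / h"
        by eventually_elim auto
      then obtain h where "h \<in> {0<..<pi/2} \<and> q < sin h / h"
        using eventually_happens trivial_limit_at_right_real by blast
      then show ?thesis using that by (auto simp: field_simps)
    qed
    define x0 where "x0 = sin h / s i"
    have sh: "0 < sin h" "sin h \<le> 1" using h by (auto intro: sin_gt_zero)
    have x0: "0 < x0" "x0 \<le> 1 / s i" using sh s0 by (auto simp: x0_def field_simps)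
    have "0 \<le> G x0"
    proof -
      have "?A x0 i = h" using h s0 by (simp add: x0_def arcsin_sin)
      moreover have "h \<le> sum s ?S * x0"
        using h(3) AC s0 by (simp add: q_def x0_def field_simps)
      moreover have "s j * x0 \<le> ?A x0 j" if "j < length d" for j
        using bd[OF that, of x0] x0 sin_x_le_x[of "?A x0 j"] arcsin_le_arcsin[of 0 "s j * x0"]
        by (simp add: sin_arcsin)
      then have "(\<Sum>j\<in>?S. s j * x0) \<le> (\<Sum>j\<in>?S. ?A x0 j)" by (intro sum_mono) auto
      ultimately show ?thesis by (simp add: G_def sum_distrib_right)
    qed
    moreover have "continuous_on ?I G"
      unfolding G_def using i(1) by (intro continuous_on_diff continuous_on_sum cont) auto
    then have "continuous_on {x0..1 / s i} G"
      by (rule continuous_on_subset) (use x0 in auto)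
    ultimately have "\<exists>x\<ge>x0. x \<le> 1 / s i \<and> G x = 0"
      using G1 x0 by (intro IVT2'[of G "1 / s i" 0 x0]) auto
    then obtain x where x: "x0 \<le> x" "x \<le> 1 / s i" "G x = 0" by auto
    define t where "t j = (if j = i then pi - ?A x i else ?A x j)" for j
    have "(\<Sum>j<length d. t j) = pi"
      using sum.remove[of "{..<length d}" i t] i(1) x(3) by (simp add: G_def t_def)
    then have "half_angles d (arsinh (1 / x)) t"
      using x x0 by (intro half) (auto simp: t_def)
    then show ?thesis by blast
  qed
qed

section \<open>Limits and bounds of half-angle data\<close>

text \<open>Radii and angles lie in a compact box. The limit equation has the positive number
  \<open>sinh (d ! j / 2)\<close> on its left side, which keeps both the limiting radius and the
  limiting angles away from 0.\<close>

lemma half_angles_limit: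
  fixes D :: "nat \<Rightarrow> real list"
  assumes len: "\<And>k. length (D k) = length d"
    and lim: "\<And>j. j < length d \<Longrightarrow> (\<lambda>k. D k ! j) \<longlonglongrightarrow> d ! j"
    and pos: "\<And>j. j < length d \<Longrightarrow> 0 < d ! j" and n: "length d \<ge> 3"
    and t: "\<And>k. half_angles (D k) (r k) (t k)" and B: "\<And>k. r k \<le> B"
  obtains \<sigma> \<rho> u where "strict_mono \<sigma>" "(\<lambda>k. r (\<sigma> k)) \<longlonglongrightarrow> \<rho>" "half_angles d \<rho> u"
    "\<And>j. j < length d \<Longrightarrow> (\<lambda>k. t (\<sigma> k) j) \<longlonglongrightarrow> u j"
proof -
  \<comment> \<open>The radius is stored as coordinate \<open>length d\<close>, so that one
    extraction makes angles and radii converge together.\<close>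
  define f where "f k j = (if j < length d then t k j else r k)" for k j
  have "norm (f k j) \<le> pi + B" if "j \<in> {..length d}" for k j
  proof (cases "j < length d")
    case True
    have "0 < t k j" "t k j < pi"
      using half_anglesD(4)[OF t, of j k] half_angles_less_pi[OF t, of k j] len n True by auto
    moreover have "0 \<le> B" using half_anglesD(1)[OF t, of k] B[of k] by simp
    ultimately show ?thesis using True by (simp add: f_def)
  next
    case False
    then show ?thesis
      using half_anglesD(1)[OF t, of k] B[of k] add_increasing[OF pi_ge_zero B[of k]]
      by (simp add: f_def)
  qed
  then obtain \<sigma> :: "nat \<Rightarrow> nat"
    where \<sigma>: "strict_mono \<sigma>" "\<And>j. j \<in> {..length d} \<Longrightarrow> \<exists>l. (\<lambda>k. f (\<sigma> k) j) \<longlonglongrightarrow> l"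
    using function_convergent_subsequence[of "{..length d}" f "pi + B"]
    by (metis countable_finite finite_atMost)
  then obtain l where l: "\<And>j. j \<le> length d \<Longrightarrow> (\<lambda>k. f (\<sigma> k) j) \<longlonglongrightarrow> l j"
    by (metis atMost_iff)
  have tl: "(\<lambda>k. t (\<sigma> k) j) \<longlonglongrightarrow> l j" if "j < length d" for j
    using l[of j] that by (simp add: f_def)
  have rl: "(\<lambda>k. r (\<sigma> k)) \<longlonglongrightarrow> l (length d)" using l[of "length d"] by (simp add: f_def)
  have eq: "sinh (d ! j / 2) = sinh (l (length d)) * sin (l j)" if j: "j < length d" for j
  proof (rule LIMSEQ_unique)
    have "(\<lambda>k. D (\<sigma> k) ! j) \<longlonglongrightarrow> d ! j"
      using LIMSEQ_subseq_LIMSEQ[OF lim[OF j] \<sigma>(1)] by (simp add: o_def)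
    then show "(\<lambda>k. sinh (D (\<sigma> k) ! j / 2)) \<longlonglongrightarrow> sinh (d ! j / 2)" by (intro tendsto_intros) auto
    have "(\<lambda>k. sinh (r (\<sigma> k)) * sin (t (\<sigma> k) j)) \<longlonglongrightarrow> sinh (l (length d)) * sin (l j)"
      using tl[OF j] rl by (intro tendsto_intros)
    then show "(\<lambda>k. sinh (D (\<sigma> k) ! j / 2)) \<longlonglongrightarrow> sinh (l (length d)) * sin (l j)"
      using half_anglesD(5)[OF t] j len by simp
  qed
  have nz: "sinh (l (length d)) * sin (l j) > 0" if "j < length d" for j
    using eq[OF that] pos[OF that] by (metis half_gt_zero sinh_real_pos_iff)
  have "0 \<le> l (length d)"
    using rl half_anglesD(1)[OF t] by (intro LIMSEQ_le_const) (auto intro: less_imp_le)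
  moreover have "l (length d) \<noteq> 0" using nz[of 0] n by force
  moreover have "0 \<le> l j" if "j < length d" for j
    using tl[OF that] half_anglesD(4)[OF t] that len by (intro LIMSEQ_le_const) (auto intro: less_imp_le)
  moreover have "l j \<noteq> 0" if "j < length d" for j using nz[OF that] by auto
  moreover have "(\<Sum>j<length d. l j) = pi"
  proof (rule LIMSEQ_unique)
    show "(\<lambda>k. \<Sum>j<length d. t (\<sigma> k) j) \<longlonglongrightarrow> (\<Sum>j<length d. l j)"
      by (intro tendsto_sum tl) simp
    show "(\<lambda>k. \<Sum>j<length d. t (\<sigma> k) j) \<longlonglongrightarrow> pi"
      using half_anglesD(2)[OF t] len by simp
  qed
  ultimately have "half_angles d (l (length d)) l"
    unfolding half_angles_def using pos eq by (metis less_eq_real_def)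
  then show ?thesis using that \<sigma>(1) rl tl by blast
qed

text \<open>The constant is the radius of the regular polygon with \<open>length d\<close> sides of
  length \<open>B\<close>. Some angle is at least the average \<open>pi / length d\<close>, and
  since it does not exceed \<open>pi / 2\<close>, its sine is at least that of the average.\<close>

lemma half_angles_radius_bound:
  assumes t: "half_angles d r t" and n: "length d \<ge> 3"
    and acute: "\<And>j. j < length d \<Longrightarrow> t j \<le> pi / 2" and B: "\<And>j. j < length d \<Longrightarrow> d ! j \<le> B"
  shows "r \<le> arsinh (sinh (B / 2) / sin (pi / length d))"
proof -
  have "\<exists>j<length d. pi / length d \<le> t j"
  proof (rule ccontr)
    assume "\<not> ?thesis"
    then have "(\<Sum>j<length d. t j) < (\<Sum>j<length d. pi / length d)"
      using n by (intro sum_strict_mono) (auto simp: lessThan_empty_iff)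
    then show False using half_anglesD(2)[OF t] n by (cases "length d = 0") auto
  qed
  then obtain j where j: "j < length d" "pi / length d \<le> t j" by auto
  have p: "0 < pi / length d" "pi / length d < pi"
    using n by (intro divide_pos_pos, auto simp: divide_less_eq)
  have "sin (pi / length d) \<le> sin (t j)"
    using j acute[OF j(1)] p by (intro sin_monotone_2pi_le) auto
  then have "sinh r * sin (pi / length d) \<le> sinh r * sin (t j)"
    using half_anglesD(1)[OF t] by (intro mult_left_mono) auto
  also have "\<dots> \<le> sinh (B / 2)"
    unfolding half_anglesD(5)[OF t j(1), symmetric] using B[OF j(1)] by simp
  finally have "sinh r \<le> sinh (B / 2) / sin (pi / length d)"
    using sin_gt_zero[OF p] by (simp add: field_simps)
  then show ?thesis by (metis arsinh_less_iff_real arsinh_sinh_real linorder_not_less)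
qed

section \<open>Cyclic polygons in the Klein model\<close>

text \<open>Reversed Cauchy-Schwarz inequality for the Lorentz form on the timelike vectors
  \<open>(1, x)\<close> and \<open>(1, y)\<close>. It places the argument of \<open>arcosh\<close>
  at 1 or above.\<close>

lemma one_minus_inner_ge:
  assumes "norm x < 1" "norm y < 1"
  shows "sqrt ((1 - (norm x)\<^sup>2) * (1 - (norm y)\<^sup>2)) \<le> 1 - x \<bullet> y"
proof -
  have "x \<bullet> y \<le> norm x * norm y" by (rule norm_cauchy_schwarz)
  moreover have "norm x * norm y < 1" using assms by (metis mult_strict_mono' mult_1 norm_ge_zero)
  moreover have "(1 - (norm x)\<^sup>2) * (1 - (norm y)\<^sup>2) \<le> (1 - norm x * norm y)\<^sup>2"
    using zero_le_power2[of "norm x - norm y"] by (simp add: power2_eq_square algebra_simps)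
  ultimately have "sqrt ((1 - (norm x)\<^sup>2) * (1 - (norm y)\<^sup>2)) \<le> 1 - norm x * norm y"
    by (intro real_le_lsqrt) auto
  with \<open>x \<bullet> y \<le> norm x * norm y\<close> show ?thesis by simp
qed

lemma cosh_hyp_dist:
  assumes "x \<in> hyp_plane" "y \<in> hyp_plane"
  shows "cosh (hyp_dist x y) = (1 - x \<bullet> y) / sqrt ((1 - (norm x)\<^sup>2) * (1 - (norm y)\<^sup>2))"
    "0 \<le> hyp_dist x y"
proof -
  have n: "norm x < 1" "norm y < 1" using assms by auto
  then have "(norm x)\<^sup>2 < 1" "(norm y)\<^sup>2 < 1" by (simp_all add: power_less_one_iff abs_square_less_1)
  then have "0 < sqrt ((1 - (norm x)\<^sup>2) * (1 - (norm y)\<^sup>2))" by simp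
  then have "1 \<le> (1 - x \<bullet> y) / sqrt ((1 - (norm x)\<^sup>2) * (1 - (norm y)\<^sup>2))"
    using one_minus_inner_ge[OF n] by (simp add: le_divide_eq_1)
  then show "cosh (hyp_dist x y) = (1 - x \<bullet> y) / sqrt ((1 - (norm x)\<^sup>2) * (1 - (norm y)\<^sup>2))"
    "0 \<le> hyp_dist x y"
    unfolding hyp_dist_def by (simp_all add: cosh_arcosh_real arcosh_nonneg_real)
qed

text \<open>At distance 0 the reversed Cauchy-Schwarz inequality is an equality; bounding its
  geometric mean by the arithmetic mean leaves \<open>norm (x - y) = 0\<close>.\<close>

lemma hyp_dist_eq_0_imp_eq:
  assumes "x \<in> hyp_plane" "y \<in> hyp_plane" "hyp_dist x y = 0"
  shows "x = y"
proof -
  have A: "0 < 1 - (norm x)\<^sup>2" "0 < 1 - (norm y)\<^sup>2"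
    using assms by (simp_all add: abs_square_less_1)
  then have "1 - x \<bullet> y = sqrt ((1 - (norm x)\<^sup>2) * (1 - (norm y)\<^sup>2))"
    using cosh_hyp_dist(1)[OF assms(1,2)] assms(3) by (simp add: divide_eq_1_iff split: if_splits)
  also have "\<dots> \<le> ((1 - (norm x)\<^sup>2) + (1 - (norm y)\<^sup>2)) / 2"
    using A by (intro arith_geo_mean_sqrt) auto
  finally have "(x - y) \<bullet> (x - y) \<le> 0"
    by (simp add: power2_norm_eq_inner inner_diff_left inner_diff_right inner_commute)
  then show ?thesis by (metis inner_eq_zero_iff inner_ge_zero order_antisym right_minus_eq)
qed

text \<open>The hypothesis is the law of cosines for an isosceles triangle with legs
  \<open>r\<close> and apex angle \<open>2 * x\<close>. The absolute value allows \<open>x\<close>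
  to be any half difference of angular coordinates.\<close>

lemma cosh_eq_chord:
  assumes "cosh d = (cosh r)\<^sup>2 - (sinh r)\<^sup>2 * cos (2 * x)" "0 \<le> d" "0 \<le> r"
  shows "sinh (d / 2) = sinh r * \<bar>sin (x :: real)\<bar>"
proof -
  have "cosh d = 1 + 2 * (sinh (d / 2))\<^sup>2"
    using cosh_double[of "d / 2"] cosh_square_eq[of "d / 2"] by simp
  moreover have "(cosh r)\<^sup>2 - (sinh r)\<^sup>2 * cos (2 * x) = 1 + 2 * (sinh r)\<^sup>2 * (sin x)\<^sup>2"
    unfolding cosh_square_eq cos_double_sin by (simp add: algebra_simps)
  ultimately have "(sinh (d / 2))\<^sup>2 = (sinh r * \<bar>sin x\<bar>)\<^sup>2"
    using assms(1) by (simp add: power_mult_distrib)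
  moreover have "0 \<le> sinh (d / 2)" "0 \<le> sinh r * \<bar>sin x\<bar>" using assms(2,3) by simp_all
  ultimately show ?thesis by (rule power2_eq_imp_eq)
qed

text \<open>With \<open>w p *\<^sub>R (1, p)\<close> the point of the hyperboloid above \<open>p\<close>, the numbers \<open>Y p\<close>, \<open>Re (Z p)\<close>, \<open>Im (Z p)\<close>
  in the proof are its coordinates in a Lorentz frame whose timelike vector lies above \<open>c\<close>.  On the circle
  \<open>Y = cosh r\<close> and \<open>\<bar>Z\<bar> = sinh r\<close>, and an affine function on the disk becomes, up to the factor \<open>w\<close>,
  an affine function of \<open>Z\<close>.\<close>

lemma hyp_circle_angles:
  assumes c: "c \<in> hyp_plane" and r: "0 < r" and p0: "p0 \<in> hyp_plane" "hyp_dist c p0 = r"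
  obtains \<Phi> where "\<Phi> p0 = 0" "\<And>p. 0 \<le> \<Phi> p \<and> \<Phi> p < 2 * pi"
    "\<And>p q. \<lbrakk>p \<in> hyp_plane; q \<in> hyp_plane; hyp_dist c p = r; hyp_dist c q = r\<rbrakk> \<Longrightarrow>
      sinh (hyp_dist p q / 2) = sinh r * \<bar>sin ((\<Phi> p - \<Phi> q) / 2)\<bar>"
    "\<And>a b. \<exists>\<alpha> \<beta> \<gamma>. \<forall>p\<in>hyp_plane. hyp_dist c p = r \<longrightarrow>
      (\<exists>m>0. m * (b - a \<bullet> p) = \<alpha> + \<beta> * cos (\<Phi> p) + \<gamma> * sin (\<Phi> p))"
proof -
  obtain u t where u: "norm u = 1" "c = of_real t * u" and t: "0 \<le> t" "t < 1"
  proof (cases "c = 0")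
    case True
    then show ?thesis using that[of 1 0] by simp
  next
    case False
    then show ?thesis using that[of "c / of_real (norm c)" "norm c"] c
      by (simp add: norm_divide)
  qed
  have uu: "u * cnj u = 1" using u(1) complex_norm_square[of u] by simp
  \<comment> \<open>Lorentz factor of the boost along the real axis that moves the point
    \<open>t\<close> to the origin. The rotation \<open>z\<close> below first brings
    \<open>c\<close> to \<open>t\<close>; \<open>wY\<close> and \<open>wz\<close> are the inverse
    boost, and \<open>form\<close> is the invariance of the Lorentz form.\<close>
  define g where "g = 1 / sqrt (1 - t\<^sup>2)"
  have "t\<^sup>2 < 1" using t by (simp add: abs_square_less_1)
  then have g: "0 < g" "g\<^sup>2 * (1 - t\<^sup>2) = 1" by (simp_all add: g_def power_divide)
  define w where "w p = 1 / sqrt (1 - (norm p)\<^sup>2)" for p :: complex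
  have w: "0 < w p" if "p \<in> hyp_plane" for p
    using that by (simp add: w_def abs_square_less_1)
  have dist_w: "cosh (hyp_dist p q) = w p * w q * (1 - p \<bullet> q)"
    if "p \<in> hyp_plane" "q \<in> hyp_plane" for p q
    using cosh_hyp_dist(1)[OF that] by (simp add: w_def real_sqrt_mult)
  define z where "z p = p * cnj u" for p
  have inner_z: "p \<bullet> q = z p \<bullet> z q" for p q
  proof -
    have re: "x \<bullet> y = Re (x * cnj y)" for x y by (simp add: inner_complex_def)
    have "z p * cnj (z q) = p * cnj q * (u * cnj u)" by (simp add: z_def)
    then show ?thesis using uu by (simp add: re)
  qed
  define Y where "Y p = w p * g * (1 - t * Re (z p))" for p
  define Z where "Z p = Complex (w p * g * (Re (z p) - t)) (w p * Im (z p))" for p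
  have wY: "w p = g * (Y p + t * Re (Z p))" and wz: "w p * Re (z p) = g * (Re (Z p) + t * Y p)" for p
  proof -
    have "g * (Y p + t * Re (Z p)) = w p * (g\<^sup>2 * (1 - t\<^sup>2))"
      "g * (Re (Z p) + t * Y p) = w p * Re (z p) * (g\<^sup>2 * (1 - t\<^sup>2))"
      by (simp_all add: Y_def Z_def power2_eq_square algebra_simps)
    then show "w p = g * (Y p + t * Re (Z p))" "w p * Re (z p) = g * (Re (Z p) + t * Y p)"
      using g by simp_all
  qed
  have form: "w p * w q * (1 - p \<bullet> q) = Y p * Y q - Z p \<bullet> Z q" for p q
  proof -
    have "Y p * Y q - Z p \<bullet> Z q =
      w p * w q * ((g\<^sup>2 * (1 - t\<^sup>2)) * (1 - Re (z p) * Re (z q)) - Im (z p) * Im (z q))"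
      by (simp add: Y_def Z_def inner_complex_def power2_eq_square algebra_simps)
    then show ?thesis
      unfolding g(2) inner_z[of p q] by (simp only: mult_1 inner_complex_def diff_diff_eq)
  qed
  define C where "C = {p \<in> hyp_plane. hyp_dist c p = r}"
  have YC: "Y p = cosh r" if "p \<in> C" for p
  proof -
    have "z c = of_real t" using uu by (simp add: z_def u(2))
    then have "p \<bullet> c = t * Re (z p)"
      unfolding inner_z[of p c] by (simp add: inner_complex_def)
    moreover have "norm c = t" using u t by (simp add: norm_mult)
    ultimately have "w p * w c * (1 - p \<bullet> c) = Y p"
      by (simp add: Y_def w_def g_def algebra_simps)
    then show ?thesis using dist_w[of c p] that c
      by (simp add: C_def inner_commute[of p c] mult.commute)
  qed
  have norm_Z: "norm (Z p) = sinh r" if "p \<in> C" for p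
  proof -
    have "(norm p)\<^sup>2 < 1" using that by (simp add: C_def abs_square_less_1)
    then have "w p * w p * (1 - p \<bullet> p) = 1"
      by (simp add: w_def power2_norm_eq_inner[symmetric])
    then have "Z p \<bullet> Z p = (sinh r)\<^sup>2"
      using form[of p p] YC[OF that] cosh_square_eq[of r] by (simp add: power2_eq_square)
    then have "(norm (Z p))\<^sup>2 = (sinh r)\<^sup>2" by (simp only: power2_norm_eq_inner)
    then show ?thesis by (rule power2_eq_imp_eq) (use r in simp_all)
  qed
  have C0: "p0 \<in> C" using p0 by (simp add: C_def)
  define \<Phi> where "\<Phi> p = Arg2pi (Z p / Z p0)" for p
  have Z\<Phi>: "Z p = Z p0 * cis (\<Phi> p)" if "p \<in> C" for p
  proof -
    have nz: "Z p0 \<noteq> 0" "norm (Z p / Z p0) = 1"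
      using norm_Z[OF C0] norm_Z[OF that] r by (auto simp: norm_divide)
    then have "Z p / Z p0 = cis (\<Phi> p)"
      using Arg2pi_eq[of "Z p / Z p0"] by (simp add: \<Phi>_def cis_conv_exp)
    then show ?thesis using nz by (simp add: field_simps)
  qed
  have inner_rot: "(x * a) \<bullet> (x * b) = (norm x)\<^sup>2 * (a \<bullet> b)" for x a b :: complex
    unfolding cmod_power2 by (simp add: inner_complex_def power2_eq_square algebra_simps)
  show thesis
  proof
    show "\<Phi> p0 = 0" using norm_Z[OF C0] r Arg2pi_of_real[of 1] by (auto simp: \<Phi>_def)
    show "0 \<le> \<Phi> p \<and> \<Phi> p < 2 * pi" for p
      by (simp add: \<Phi>_def Arg2pi_ge_0 Arg2pi_lt_2pi)
  next
    fix p q assume pq: "p \<in> hyp_plane" "q \<in> hyp_plane" "hyp_dist c p = r" "hyp_dist c q = r"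
    then have C: "p \<in> C" "q \<in> C" by (auto simp: C_def)
    have "Z p \<bullet> Z q = (sinh r)\<^sup>2 * cos (\<Phi> p - \<Phi> q)"
      using Z\<Phi>[OF C(1)] Z\<Phi>[OF C(2)] norm_Z[OF C0] inner_rot[of "Z p0" "cis (\<Phi> p)" "cis (\<Phi> q)"]
      by (simp add: inner_complex_def cos_diff)
    then have "cosh (hyp_dist p q) = (cosh r)\<^sup>2 - (sinh r)\<^sup>2 * cos (\<Phi> p - \<Phi> q)"
      using dist_w[OF pq(1,2)] form[of p q] YC C by (simp add: power2_eq_square)
    moreover have "\<Phi> p - \<Phi> q = 2 * ((\<Phi> p - \<Phi> q) / 2)" by simp
    ultimately have "cosh (hyp_dist p q) = (cosh r)\<^sup>2 - (sinh r)\<^sup>2 * cos (2 * ((\<Phi> p - \<Phi> q) / 2))"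
      by metis
    then show "sinh (hyp_dist p q / 2) = sinh r * \<bar>sin ((\<Phi> p - \<Phi> q) / 2)\<bar>"
      using cosh_hyp_dist(2)[OF pq(1,2)] r by (intro cosh_eq_chord) auto
  next
    fix a :: complex and b
    \<comment> \<open>The linear part left over when the inverse boost is inserted into
      \<open>w p * (b - a \<bullet> p)\<close> and \<open>Y p\<close> is replaced by the constant
      \<open>cosh r\<close>.\<close>
    define v where "v = Complex (g * (b * t - Re (z a))) (- Im (z a))"
    let ?v = "Z p0 * cnj v"
    have "w p * (b - a \<bullet> p) = g * cosh r * (b - t * Re (z a)) + Re ?v * cos (\<Phi> p) + - Im ?v * sin (\<Phi> p)"
      if p: "p \<in> C" for p
    proof -
      have "w p * (b - a \<bullet> p) = b * w p - Re (z a) * (w p * Re (z p)) - Im (z a) * Im (Z p)"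
        unfolding inner_z[of a p] by (simp add: inner_complex_def Z_def algebra_simps)
      also have "\<dots> = g * cosh r * (b - t * Re (z a)) + v \<bullet> Z p"
        unfolding wz[of p] unfolding wY[of p] YC[OF p]
        by (simp add: v_def inner_complex_def algebra_simps)
      also have "v \<bullet> Z p = Re ?v * cos (\<Phi> p) + - Im ?v * sin (\<Phi> p)"
        unfolding Z\<Phi>[OF p] by (simp add: inner_complex_def algebra_simps)
      finally show ?thesis by simp
    qed
    then show "\<exists>\<alpha> \<beta> \<gamma>. \<forall>p\<in>hyp_plane. hyp_dist c p = r \<longrightarrow>
      (\<exists>m>0. m * (b - a \<bullet> p) = \<alpha> + \<beta> * cos (\<Phi> p) + \<gamma> * sin (\<Phi> p))"
      using w unfolding C_def by blast
  qed
qed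

section \<open>From a polygon to its half angles\<close>

text \<open>Faces of a polytope are exposed, which gives the line. A further vertex is strictly on
  one side of it: otherwise it would lie on the side, in whose interior no extreme point can
  be.\<close>

lemma convex_polygon_supporting_line:
  assumes "convex_polygon ps" "i < length ps"
  obtains a b where "a \<bullet> ps ! i = b" "a \<bullet> ps ! (Suc i mod length ps) = b"
    "\<And>k. \<lbrakk>k < length ps; k \<noteq> i; k \<noteq> Suc i mod length ps\<rbrakk> \<Longrightarrow> a \<bullet> ps ! k < b"
proof -
  let ?H = "convex hull (set ps)" and ?x = "ps ! i" and ?y = "ps ! (Suc i mod length ps)"
  have j: "Suc i mod length ps < length ps" using assms(2) by (intro mod_less_divisor) auto
  have "closed_segment ?x ?y face_of ?H"
    using assms unfolding convex_polygon_def edge_of_def by blast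
  then have "closed_segment ?x ?y exposed_face_of ?H"
    using exposed_face_of_polyhedron polyhedron_convex_hull by blast
  then obtain a b where ab: "?H \<subseteq> {x. a \<bullet> x \<le> b}" "closed_segment ?x ?y = ?H \<inter> {x. a \<bullet> x = b}"
    unfolding exposed_face_of_def by blast
  have "a \<bullet> ps ! k < b" if k: "k < length ps" "k \<noteq> i" "k \<noteq> Suc i mod length ps" for k
  proof -
    have kH: "ps ! k \<in> ?H" using k by (intro hull_inc) auto
    have "ps ! k \<notin> open_segment ?x ?y"
    proof -
      have "ps ! k extreme_point_of ?H" using assms(1) k(1) unfolding convex_polygon_def by auto
      moreover have "?x \<in> ?H" "?y \<in> ?H" using assms(2) j by (auto intro!: hull_inc)
      ultimately show ?thesis unfolding extreme_point_of_def by blast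
    qed
    moreover have "ps ! k \<noteq> ?x" "ps ! k \<noteq> ?y"
      using assms k j by (auto simp: convex_polygon_def nth_eq_iff_index_eq)
    ultimately have "ps ! k \<notin> closed_segment ?x ?y" by (auto simp: open_segment_def)
    then show ?thesis using ab kH by force
  qed
  moreover have "a \<bullet> ?x = b" "a \<bullet> ?y = b" using ab(2) ends_in_segment by blast+
  ultimately show ?thesis using that by blast
qed

text \<open>With midpoint \<open>m\<close> and half difference \<open>h\<close> of the zeros,
  subtracting the two equations shows that \<open>(\<beta>, \<gamma>)\<close> is parallel to
  \<open>(cos m, sin m)\<close>. The function is then a multiple of
  \<open>cos (z - m) - cos h\<close>, and the product formula factors it.\<close>

lemma trig_two_zeros:
  fixes \<alpha> \<beta> \<gamma> x y :: real
  assumes "\<alpha> + \<beta> * cos x + \<gamma> * sin x = 0" "\<alpha> + \<beta> * cos y + \<gamma> * sin y = 0" "sin ((x - y) / 2) \<noteq> 0"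
  obtains \<kappa> where "\<And>z. \<alpha> + \<beta> * cos z + \<gamma> * sin z = \<kappa> * sin ((z - x) / 2) * sin ((z - y) / 2)"
proof -
  define m h where "m = (x + y) / 2" and "h = (x - y) / 2"
  have xy: "x = m + h" "y = m - h" by (simp_all add: m_def h_def field_simps)
  have "2 * (sin h * (\<gamma> * cos m - \<beta> * sin m)) =
      (\<alpha> + \<beta> * cos x + \<gamma> * sin x) - (\<alpha> + \<beta> * cos y + \<gamma> * sin y)"
    unfolding xy by (simp add: cos_add sin_add cos_diff sin_diff algebra_simps)
  then have "sin h * (\<gamma> * cos m - \<beta> * sin m) = 0"
    unfolding assms by simp
  then have gm: "\<gamma> * cos m = \<beta> * sin m" using assms(3) by (simp add: h_def)
  define \<rho> where "\<rho> = \<beta> * cos m + \<gamma> * sin m"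
  have b: "\<rho> * cos m = \<beta>"
  proof -
    have "\<rho> * cos m = \<beta> * (cos m)\<^sup>2 + sin m * (\<gamma> * cos m)" by (simp add: \<rho>_def power2_eq_square algebra_simps)
    also have "\<dots> = \<beta> * ((cos m)\<^sup>2 + (sin m)\<^sup>2)" unfolding gm by (simp only: power2_eq_square distrib_left mult_ac)
    finally show ?thesis by simp
  qed
  have c: "\<rho> * sin m = \<gamma>"
  proof -
    have "\<rho> * sin m = \<gamma> * (sin m)\<^sup>2 + cos m * (\<beta> * sin m)" by (simp add: \<rho>_def power2_eq_square algebra_simps)
    also have "\<dots> = \<gamma> * ((cos m)\<^sup>2 + (sin m)\<^sup>2)" unfolding gm[symmetric] by (simp only: power2_eq_square distrib_left mult_ac add_ac)
    finally show ?thesis by simp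
  qed
  have z: "\<beta> * cos z + \<gamma> * sin z = \<rho> * cos (z - m)" for z
    unfolding b[symmetric] c[symmetric] by (simp add: cos_diff algebra_simps)
  have "\<alpha> = - \<rho> * cos h" using assms(1) z[of x] xy by simp
  then have "\<alpha> + \<beta> * cos w + \<gamma> * sin w = \<rho> * (cos (w - m) - cos h)" for w
    using z[of w] by (simp add: algebra_simps)
  moreover have "cos (w - m) - cos h = - 2 * sin ((w - x) / 2) * sin ((w - y) / 2)" for w
  proof -
    have "w - m = (w - x) / 2 + (w - y) / 2" "h = (w - y) / 2 - (w - x) / 2"
      by (simp_all add: m_def h_def field_simps)
    then show ?thesis by (simp only: cos_add cos_diff) simp
  qed
  ultimately show ?thesis using that[of "- 2 * \<rho>"] by (metis (no_types, lifting) mult.assoc mult.commute)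
qed

lemma sin_half_pos_iff:
  fixes x :: real
  assumes "\<bar>x\<bar> < 2 * pi"
  shows "0 < sin (x / 2) \<longleftrightarrow> 0 < x" "sin (x / 2) < 0 \<longleftrightarrow> x < 0"
proof -
  have "0 < sin (x / 2)" if "0 < x" using that assms by (intro sin_gt_zero) auto
  moreover have "0 < sin (- x / 2)" if "x < 0" using that assms by (intro sin_gt_zero) auto
  ultimately show "0 < sin (x / 2) \<longleftrightarrow> 0 < x" "sin (x / 2) < 0 \<longleftrightarrow> x < 0"
    by (cases x "0 :: real" rule: linorder_cases; force)+
qed

lemma cos_eq_sin_half: "cos x = 1 - 2 * (sin (x / 2))\<^sup>2" for x :: real
  using cos_double_sin[of "x / 2"] by simp

text \<open>Within \<open>[0, 2 * pi)\<close> a half-angle sine has the sign of the difference, so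
  by the factorization \<open>g z\<close> has the sign of \<open>(z - a) * (z - b)\<close> up to a
  common factor. Hence \<open>x\<close> and \<open>y\<close> are both between \<open>a\<close> and
  \<open>b\<close> or both outside.\<close>

lemma trig_same_sign:
  fixes \<alpha> \<beta> \<gamma> a b x y :: real
  assumes g: "\<And>z. g z = \<alpha> + \<beta> * cos z + \<gamma> * sin z"
    and "g a = 0" "g b = 0" "0 < g x" "0 < g y" "a \<noteq> b"
    and range: "{a, b, x, y} \<subseteq> {0..<2 * pi}"
  shows "0 < ((x - a) * (x - b)) * ((y - a) * (y - b))"
proof -
  have abs: "\<bar>u - v\<bar> < 2 * pi" if "u \<in> {a, b, x, y}" "v \<in> {a, b, x, y}" for u v
  proof -
    have "u \<in> {0..<2 * pi}" "v \<in> {0..<2 * pi}" using range that by blast+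
    then show ?thesis by (simp add: abs_less_iff)
  qed
  have sg: "sgn (sin ((u - v) / 2)) = sgn (u - v)" if "u \<in> {a, b, x, y}" "v \<in> {a, b, x, y}" for u v
    using sin_half_pos_iff[OF abs[OF that]] by (cases u v rule: linorder_cases) auto
  have "sin ((a - b) / 2) \<noteq> 0" using sg[of a b] \<open>a \<noteq> b\<close> by (auto simp: sgn_if split: if_splits)
  then obtain \<kappa> where \<kappa>: "\<And>z. g z = \<kappa> * sin ((z - a) / 2) * sin ((z - b) / 2)"
    using trig_two_zeros[of \<alpha> \<beta> a \<gamma> b] assms(2,3) unfolding g by metis
  have "sgn (g x) = sgn \<kappa> * sgn ((x - a) * (x - b))" "sgn (g y) = sgn \<kappa> * sgn ((y - a) * (y - b))"
    unfolding \<kappa> by (simp_all add: sgn_mult sg)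
  then have "sgn \<kappa> * sgn ((x - a) * (x - b)) = 1" "sgn \<kappa> * sgn ((y - a) * (y - b)) = 1"
    using assms(4,5) by simp_all
  then have "sgn (((x - a) * (x - b)) * ((y - a) * (y - b))) = 1"
    unfolding sgn_mult[of "(x - a) * (x - b)"] by (auto simp: sgn_if split: if_splits)
  then show ?thesis by (simp only: sgn_1_pos)
qed

text \<open>The minimum \<open>f 0\<close> lies outside the interval of any side not containing
  vertex 0. For \<open>i = Suc j\<close> with \<open>j > 0\<close>, comparison with it along the
  side from \<open>i\<close> shows that \<open>f j\<close> is outside too, so
  \<open>f j < f (Suc i)\<close>; along the side from \<open>j\<close> it then forces
  \<open>f i < f (Suc i)\<close>. For \<open>i = 1\<close> the vertex before is 0 itself and the
  argument is void: \<open>f12\<close> is the choice of orientation.\<close>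

lemma cyclic_order_increasing:
  fixes f :: "nat \<Rightarrow> real"
  assumes f0: "\<And>k. \<lbrakk>0 < k; k < n\<rbrakk> \<Longrightarrow> f 0 < f k"
    and sep: "\<And>i k l. \<lbrakk>Suc i < n; k < n; l < n; k \<noteq> i; k \<noteq> Suc i; l \<noteq> i; l \<noteq> Suc i\<rbrakk> \<Longrightarrow>
      0 < ((f k - f i) * (f k - f (Suc i))) * ((f l - f i) * (f l - f (Suc i)))"
    and f12: "2 < n \<Longrightarrow> f 1 < f 2"
    and i: "Suc i < n"
  shows "f i < f (Suc i)"
  using i
proof (induction i rule: less_induct)
  case (less i)
  consider "i = 0" | "i = 1" | j where "i = Suc j" "0 < j"
    by (metis One_nat_def gr0I not0_implies_Suc)
  then show ?case
  proof cases
    case 1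
    then show ?thesis using f0[of 1] less.prems by simp
  next
    case 2
    then show ?thesis using f12 less.prems by (simp add: numeral_2_eq_2)
  next
    case 3
    let ?h = "f (Suc i)"
    have lt: "f j < f i" using less.IH[of j] less.prems 3 by simp
    have "0 < ((f 0 - f i) * (f 0 - ?h)) * ((f j - f i) * (f j - ?h))"
      using sep[of i 0 j] less.prems 3 by simp
    moreover have "0 < (f 0 - f i) * (f 0 - ?h)"
      using f0[of i] f0[of "Suc i"] less.prems 3 by (intro mult_neg_neg) auto
    ultimately have "0 < (f j - f i) * (f j - ?h)" by (simp add: zero_less_mult_iff)
    then have jh: "f j < ?h" using lt by (auto simp: zero_less_mult_iff)
    have "0 < ((f 0 - f j) * (f 0 - f i)) * ((?h - f j) * (?h - f i))"
      using sep[of j 0 "Suc i"] less.prems 3 by simp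
    moreover have "0 < (f 0 - f j) * (f 0 - f i)"
      using f0[of i] f0[of j] less.prems 3 by (intro mult_neg_neg) auto
    ultimately have "0 < (?h - f j) * (?h - f i)" by (simp add: zero_less_mult_iff)
    then show ?thesis using jh by (auto simp: zero_less_mult_iff)
  qed
qed

lemma half_gaps_increasing:
  fixes f :: "nat \<Rightarrow> real"
  assumes n: "n \<ge> 3" and f: "f 0 = 0" "\<And>k. k < n \<Longrightarrow> f k < 2 * pi"
    and inc: "\<And>i. Suc i < n \<Longrightarrow> f i < f (Suc i)"
  obtains t where "(\<Sum>i<n. t i) = pi" "\<And>i. i < n \<Longrightarrow> 0 < t i"
    "\<And>i. i < n \<Longrightarrow> sin (t i) = \<bar>sin ((f i - f (Suc i mod n)) / 2)\<bar>"
proof -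
  \<comment> \<open>Index \<open>n\<close> stands for vertex 0 after a full turn, so the gaps
    telescope to \<open>2 * pi\<close>. For the last side the half difference of the coordinates is
    \<open>pi - t i\<close>, with the same sine.\<close>
  define g where "g k = (if k < n then f k else 2 * pi)" for k
  define t where "t i = (g (Suc i) - g i) / 2" for i
  have pos: "0 < t i" if "i < n" for i
    using that inc[of i] f(2)[of i] by (auto simp: t_def g_def)
  have sum: "(\<Sum>i<n. t i) = pi"
  proof -
    have "(\<Sum>i<n. t i) = (g n - g 0) / 2"
      unfolding t_def sum_divide_distrib[symmetric] sum_lessThan_telescope by simp
    then show ?thesis using n f(1) by (simp add: g_def)
  qed
  have "t i \<le> pi" if "i < n" for i
    using sum member_le_sum[of i "{..<n}" t] pos that by (auto intro: less_imp_le)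
  then have sin: "sin (t i) = \<bar>sin (t i)\<bar>" if "i < n" for i
    using that pos[OF that] sin_ge_zero[of "t i"] by simp
  have "sin (t i) = \<bar>sin ((f i - f (Suc i mod n)) / 2)\<bar>" if i: "i < n" for i
  proof (cases "Suc i < n")
    case True
    have eq: "(f i - f (Suc i mod n)) / 2 = - t i" using True by (simp add: t_def g_def field_simps)
    show ?thesis unfolding eq sin_minus abs_minus_cancel by (rule sin[OF i])
  next
    case False
    then have "Suc i = n" using i by simp
    then have eq: "(f i - f (Suc i mod n)) / 2 = pi - t i"
      using f(1) i by (simp add: t_def g_def field_simps)
    show ?thesis unfolding eq sin_pi_minus by (rule sin[OF i])
  qed
  then show ?thesis using that sum pos by blast
qed

text \<open>The line through a side is the zero set of an affine function positive at the other vertices.  On the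
  circle it becomes \<open>\<alpha> + \<beta> cos \<phi> + \<gamma> sin \<phi>\<close>, so two further vertices are never separated by the ends of
  the side.  This forces the angles of consecutive vertices to be monotone, up to reflection.\<close>

lemma cyclic_polygon_half_angles:
  assumes "cyclic_polygon ps r" "\<And>i. i < length ps \<Longrightarrow> 0 < side_lengths ps ! i"
  obtains t where "half_angles (side_lengths ps) r t"
proof -
  define n where "n = length ps"
  obtain c where cp: "convex_polygon ps" and c: "c \<in> hyp_plane" "\<And>p. p \<in> set ps \<Longrightarrow> hyp_dist c p = r"
    using assms(1) unfolding cyclic_polygon_def by blast
  have n: "n \<ge> 3" and dist: "distinct ps" and hp: "set ps \<subseteq> hyp_plane"
    using cp by (auto simp: convex_polygon_def n_def)
  let ?s = "\<lambda>i. Suc i mod n"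
  have s: "?s i < n" for i using n by simp
  have ps: "ps ! k \<in> hyp_plane" "hyp_dist c (ps ! k) = r" if "k < n" for k
    using nth_mem[of k ps] that hp c(2) unfolding n_def by blast+
  have side: "side_lengths ps ! i = hyp_dist (ps ! i) (ps ! ?s i)" if "i < n" for i
    using that by (simp add: side_lengths_def n_def)
  have r: "0 < r"
  proof -
    have "0 \<le> r" using cosh_hyp_dist(2)[OF c(1) ps(1), of 0] ps(2)[of 0] n by simp
    moreover have "r \<noteq> 0"
    proof
      assume "r = 0"
      then have "ps ! 0 = ps ! 1"
        using hyp_dist_eq_0_imp_eq[OF c(1)] ps[of 0] ps[of 1] n
        by (metis less_le_trans one_less_numeral_iff semiring_norm(77) zero_less_numeral)
      moreover have "0 < length ps" "1 < length ps" using n unfolding n_def by linarith+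
      ultimately show False using nth_eq_iff_index_eq[OF dist, of 0 1] by (metis zero_neq_one)
    qed
    ultimately show ?thesis by simp
  qed
  have "0 < n" using n by simp
  obtain \<Phi> where \<Phi>: "\<Phi> (ps ! 0) = 0" "\<And>p. 0 \<le> \<Phi> p \<and> \<Phi> p < 2 * pi"
    "\<And>p q. \<lbrakk>p \<in> hyp_plane; q \<in> hyp_plane; hyp_dist c p = r; hyp_dist c q = r\<rbrakk> \<Longrightarrow>
      sinh (hyp_dist p q / 2) = sinh r * \<bar>sin ((\<Phi> p - \<Phi> q) / 2)\<bar>"
    "\<And>a b. \<exists>\<alpha> \<beta> \<gamma>. \<forall>p\<in>hyp_plane. hyp_dist c p = r \<longrightarrow>
      (\<exists>m>0. m * (b - a \<bullet> p) = \<alpha> + \<beta> * cos (\<Phi> p) + \<gamma> * sin (\<Phi> p))"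
    by (rule hyp_circle_angles[OF c(1) r ps[OF \<open>0 < n\<close>]]) (rule that)
  define \<phi> where "\<phi> k = \<Phi> (ps ! k)" for k
  have \<phi>: "\<phi> 0 = 0" "\<And>k. 0 \<le> \<phi> k" "\<And>k. \<phi> k < 2 * pi" using \<Phi>(1,2) by (auto simp: \<phi>_def)
  have inj: "\<phi> k \<noteq> \<phi> l" if kl: "k < n" "l < n" "k \<noteq> l" for k l
  proof
    assume "\<phi> k = \<phi> l"
    then have "hyp_dist (ps ! k) (ps ! l) = 0"
      using \<Phi>(3)[OF ps(1)[OF kl(1)] ps(1)[OF kl(2)] ps(2)[OF kl(1)] ps(2)[OF kl(2)]]
      by (simp add: \<phi>_def)
    then have "ps ! k = ps ! l" using hyp_dist_eq_0_imp_eq ps(1) kl by blast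
    then show False using dist kl by (simp add: nth_eq_iff_index_eq n_def)
  qed
  have \<phi>pos: "0 < \<phi> k" if "0 < k" "k < n" for k
    using \<phi>(1) \<phi>(2)[of k] inj[of k 0] that by fastforce
  have line: "\<exists>\<alpha> \<beta> \<gamma>. \<forall>k<n. let g = \<alpha> + \<beta> * cos (\<phi> k) + \<gamma> * sin (\<phi> k)
      in if k \<in> {i, ?s i} then g = 0 else 0 < g" if i: "i < n" for i
  proof -
    obtain a b where ab: "a \<bullet> ps ! i = b" "a \<bullet> ps ! ?s i = b"
      "\<And>k. \<lbrakk>k < n; k \<noteq> i; k \<noteq> ?s i\<rbrakk> \<Longrightarrow> a \<bullet> ps ! k < b"
      using convex_polygon_supporting_line[OF cp, of i] i unfolding n_def by blast
    obtain \<alpha> \<beta> \<gamma> where *: "\<And>p. p \<in> hyp_plane \<Longrightarrow> hyp_dist c p = r \<Longrightarrow>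
      \<exists>m>0. m * (b - a \<bullet> p) = \<alpha> + \<beta> * cos (\<Phi> p) + \<gamma> * sin (\<Phi> p)"
      using \<Phi>(4)[where b = b and a = a] by blast
    have "let g = \<alpha> + \<beta> * cos (\<phi> k) + \<gamma> * sin (\<phi> k)
      in if k \<in> {i, ?s i} then g = 0 else 0 < g" if k: "k < n" for k
    proof -
      obtain m where m: "m > 0" "m * (b - a \<bullet> ps ! k) = \<alpha> + \<beta> * cos (\<phi> k) + \<gamma> * sin (\<phi> k)"
        using *[OF ps[OF k]] unfolding \<phi>_def by blast
      then show ?thesis using ab(1,2) ab(3)[OF k] unfolding Let_def m(2)[symmetric] by auto
    qed
    then show ?thesis by blast
  qed
  \<comment> \<open>The list \<open>f\<close> will be \<open>\<phi>\<close> (with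
    \<open>e = 1\<close>) or its reflection (with \<open>e = - 1\<close>); reflecting only replaces
    \<open>\<gamma>\<close> by \<open>e * \<gamma>\<close>.\<close>
  have sep: "0 < ((f k - f i) * (f k - f (Suc i))) * ((f l - f i) * (f l - f (Suc i)))"
    if f: "\<And>k. k < n \<Longrightarrow> f k \<in> {0..<2 * pi}" "\<And>k. k < n \<Longrightarrow> cos (f k) = cos (\<phi> k)"
      "\<And>k. k < n \<Longrightarrow> sin (f k) = e * sin (\<phi> k)" "e * e = 1"
    and i: "Suc i < n" and kl: "k < n" "l < n" "k \<noteq> i" "k \<noteq> Suc i" "l \<noteq> i" "l \<noteq> Suc i"
    for f e i k l
  proof -
    obtain \<alpha> \<beta> \<gamma> where *: "\<And>k. k < n \<Longrightarrow> let g = \<alpha> + \<beta> * cos (\<phi> k) + \<gamma> * sin (\<phi> k)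
      in if k \<in> {i, Suc i} then g = 0 else 0 < g"
      using line[of i] i by auto
    have g: "\<alpha> + \<beta> * cos (f k) + (e * \<gamma>) * sin (f k) = \<alpha> + \<beta> * cos (\<phi> k) + \<gamma> * sin (\<phi> k)"
      if "k < n" for k
    proof -
      have "(e * \<gamma>) * sin (f k) = (e * e) * \<gamma> * sin (\<phi> k)" using f(3)[OF that] by simp
      then show ?thesis using f(2)[OF that] f(4) by simp
    qed
    show ?thesis
    proof (rule trig_same_sign[of "\<lambda>z. \<alpha> + \<beta> * cos z + (e * \<gamma>) * sin z"])
      show "f i \<noteq> f (Suc i)"
      proof
        assume eq: "f i = f (Suc i)"
        have "sin (\<phi> k) = e * sin (f k)" if "k < n" for k using f(3,4) that by simp
        then have "sin (\<phi> i) = sin (\<phi> (Suc i))" "cos (\<phi> i) = cos (\<phi> (Suc i))"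
          using eq i f(2)[of i] f(2)[of "Suc i"] by simp_all
        then have "cos (\<phi> i - \<phi> (Suc i)) = 1" by (simp add: cos_diff flip: power2_eq_square)
        then have "sin ((\<phi> i - \<phi> (Suc i)) / 2) = 0"
          unfolding cos_eq_sin_half by simp
        then have "\<phi> i = \<phi> (Suc i)"
          using sin_half_pos_iff[of "\<phi> i - \<phi> (Suc i)"] \<phi>(2,3)[of i] \<phi>(2,3)[of "Suc i"]
          by (simp add: abs_less_iff)
        then show False using inj[of i "Suc i"] i by simp
      qed
      show "\<alpha> + \<beta> * cos (f i) + (e * \<gamma>) * sin (f i) = 0"
        by (subst g) (use *[of i] i in \<open>simp_all add: Let_def\<close>)
      show "\<alpha> + \<beta> * cos (f (Suc i)) + (e * \<gamma>) * sin (f (Suc i)) = 0"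
        by (subst g) (use *[of "Suc i"] i in \<open>simp_all add: Let_def\<close>)
      show "0 < \<alpha> + \<beta> * cos (f k) + (e * \<gamma>) * sin (f k)"
        by (subst g) (use *[of k] kl in \<open>simp_all add: Let_def\<close>)
      show "0 < \<alpha> + \<beta> * cos (f l) + (e * \<gamma>) * sin (f l)"
        by (subst g) (use *[of l] kl in \<open>simp_all add: Let_def\<close>)
    qed (use i kl f(1) in auto)
  qed
  obtain f where f: "f 0 = 0" "\<And>k. k < n \<Longrightarrow> f k < 2 * pi" "\<And>i. Suc i < n \<Longrightarrow> f i < f (Suc i)"
    "\<And>k l. \<lbrakk>k < n; l < n\<rbrakk> \<Longrightarrow> \<bar>sin ((f k - f l) / 2)\<bar> = \<bar>sin ((\<phi> k - \<phi> l) / 2)\<bar>"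
  proof (cases "\<phi> 1 < \<phi> 2")
    case True
    have "\<phi> i < \<phi> (Suc i)" if "Suc i < n" for i
    proof (rule cyclic_order_increasing[of n \<phi>])
      show "0 < ((\<phi> k - \<phi> i) * (\<phi> k - \<phi> (Suc i))) * ((\<phi> l - \<phi> i) * (\<phi> l - \<phi> (Suc i)))"
        if "Suc i < n" "k < n" "l < n" "k \<noteq> i" "k \<noteq> Suc i" "l \<noteq> i" "l \<noteq> Suc i" for i k l
        using sep[of \<phi> 1 i k l] that \<phi> by auto
    qed (use True that \<phi>pos \<phi>(1) in auto)
    then show ?thesis using \<phi> by (intro that[of \<phi>]) auto
  next
    case False
    \<comment> \<open>Reflection of the circle reverses the orientation; vertex 0 keeps coordinate 0
      instead of moving to \<open>2 * pi\<close>.\<close>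
    define f where "f k = (if k = 0 then 0 else 2 * pi - \<phi> k)" for k
    have frange: "f k \<in> {0..<2 * pi}" if "k < n" for k
      using \<phi>pos[of k] \<phi>(3)[of k] that by (auto simp: f_def)
    have cs: "cos (f k) = cos (\<phi> k)" "sin (f k) = - 1 * sin (\<phi> k)" for k
      using \<phi>(1) by (auto simp: f_def cos_diff sin_diff)
    have "f i < f (Suc i)" if "Suc i < n" for i
    proof (rule cyclic_order_increasing[of n f])
      show "f 0 < f k" if "0 < k" "k < n" for k
        using that \<phi>(3)[of k] by (simp add: f_def)
      show "f 1 < f 2" if "2 < n" using False inj[of 1 2] that by (simp add: f_def)
      show "0 < ((f k - f i) * (f k - f (Suc i))) * ((f l - f i) * (f l - f (Suc i)))"
        if "Suc i < n" "k < n" "l < n" "k \<noteq> i" "k \<noteq> Suc i" "l \<noteq> i" "l \<noteq> Suc i" for i k l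
        using sep[of f "- 1" i k l] that frange cs by simp
    qed (use that in auto)
    moreover have "\<bar>sin ((f k - f l) / 2)\<bar> = \<bar>sin ((\<phi> k - \<phi> l) / 2)\<bar>" for k l
    proof -
      have "cos (f k - f l) = cos (\<phi> k - \<phi> l)" by (simp add: cos_diff cs)
      then have "(sin ((f k - f l) / 2))\<^sup>2 = (sin ((\<phi> k - \<phi> l) / 2))\<^sup>2"
        unfolding cos_eq_sin_half by simp
      then show ?thesis by (simp only: power2_eq_iff abs_eq_iff)
    qed
    ultimately show ?thesis using \<phi>pos frange by (intro that[of f]) (auto simp: f_def)
  qed
  obtain t where t: "(\<Sum>i<n. t i) = pi" "\<And>i. i < n \<Longrightarrow> 0 < t i"
    "\<And>i. i < n \<Longrightarrow> sin (t i) = \<bar>sin ((f i - f (Suc i mod n)) / 2)\<bar>"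
    using half_gaps_increasing[OF n f(1-3)] by blast
  have "length (side_lengths ps) = n" by (simp add: side_lengths_def n_def)
  moreover have "sinh (side_lengths ps ! i / 2) = sinh r * sin (t i)" if i: "i < n" for i
    using \<Phi>(3)[OF ps(1)[OF i] ps(1)[OF s[of i]] ps(2)[OF i] ps(2)[OF s[of i]]]
      t(3)[OF i] f(4)[OF i s[of i]] side[OF i] by (simp add: \<phi>_def)
  ultimately have "half_angles (side_lengths ps) r t"
    using r t assms(2) by (auto simp: half_angles_def n_def)
  then show ?thesis using that by blast
qed

section \<open>From half angles to a polygon\<close>

lemma face_of_convex_hull_supporting:
  fixes S :: "'a::euclidean_space set"
  assumes "finite S" "T \<subseteq> S" "\<And>x. x \<in> T \<Longrightarrow> a \<bullet> x = b" "\<And>x. x \<in> S - T \<Longrightarrow> a \<bullet> x < b"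
  shows "convex hull T face_of convex hull S"
proof (rule face_of_convex_hulls[OF assms(1,2)])
  have "affine hull T \<subseteq> {x. a \<bullet> x = b}"
    using assms(3) by (intro hull_minimal affine_hyperplane) auto
  moreover have "convex hull (S - T) \<subseteq> {x. a \<bullet> x < b}"
    using assms(4) by (intro hull_minimal convex_halfspace_lt) auto
  ultimately show "affine hull T \<inter> convex hull (S - T) = {}" by fastforce
qed

lemma cos_less_cos_of_arc:
  fixes x y :: real
  assumes "0 \<le> y" "y < x" "x < 2 * pi - y"
  shows "cos x < cos y"
proof (cases "x \<le> pi")
  case True
  then show ?thesis using assms by (intro cos_monotone_0_pi) auto
next
  case False
  then have "cos (2 * pi - x) < cos y" using assms by (intro cos_monotone_0_pi) auto
  then show ?thesis by (simp add: cos_diff)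
qed

text \<open>Vertices are placed at the partial sums of the central angles on the Euclidean circle of
  radius \<open>tanh r\<close> about the origin, which is the hyperbolic circle of radius
  \<open>r\<close>. The direction of a vertex exposes that vertex; the direction bisecting the arc
  of side \<open>i\<close> exposes that side.\<close>

lemma half_angles_cyclic_polygon:
  assumes t: "half_angles d r t" and n: "length d \<ge> 3"
  shows "\<exists>ps. cyclic_polygon ps r \<and> side_lengths ps = d"
proof -
  define n where "n = length d"
  define \<phi> where "\<phi> k = 2 * (\<Sum>j<k. t j)" for k
  have r: "0 < r" and tp: "\<And>i. i < n \<Longrightarrow> 0 < t i" and n3: "n \<ge> 3"
    using half_anglesD[OF t] n by (auto simp: n_def)
  have tpi: "t i < pi" if "i < n" for i using half_angles_less_pi[OF t n] that by (simp add: n_def)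
  have \<phi>0: "\<phi> 0 = 0" "\<phi> n = 2 * pi" using half_anglesD(2)[OF t] by (auto simp: \<phi>_def n_def)
  have \<phi>S: "\<phi> (Suc i) = \<phi> i + 2 * t i" for i by (simp add: \<phi>_def)
  have mono: "\<phi> k < \<phi> l" if "k < l" "l \<le> n" for k l
    using that
  proof (induction l)
    case (Suc l)
    then show ?case using \<phi>S[of l] tp[of l] by (cases "k = l") auto
  qed simp
  have range: "0 \<le> \<phi> k" "\<phi> k < 2 * pi" if "k < n" for k
    using mono[of 0 k] mono[of k n] \<phi>0 that by (cases "k = 0"; simp)+
  define h where "h = tanh r"
  have h: "0 < h" "h < 1" using r by (auto simp: h_def tanh_real_lt_1)
  have h2: "1 - h\<^sup>2 = 1 / (cosh r)\<^sup>2" "(cosh r)\<^sup>2 * h\<^sup>2 = (sinh r)\<^sup>2"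
  proof -
    have "(cosh r)\<^sup>2 \<noteq> 0" by simp
    then show "1 - h\<^sup>2 = 1 / (cosh r)\<^sup>2" "(cosh r)\<^sup>2 * h\<^sup>2 = (sinh r)\<^sup>2"
      using cosh_square_eq[of r] by (simp_all add: h_def tanh_def power_divide field_simps)
  qed
  define p where "p k = of_real h * cis (\<phi> k)" for k
  have norm_p: "norm (p k) = h" for k using h by (simp add: p_def norm_mult)
  have inner_p: "cis y \<bullet> p k = h * cos (\<phi> k - y)" for k y
    by (simp add: p_def inner_complex_def cos_diff algebra_simps)
  have inner_pp: "p k \<bullet> p l = h\<^sup>2 * cos (\<phi> k - \<phi> l)" for k l
    by (simp add: p_def inner_complex_def cos_diff power2_eq_square algebra_simps)
  have cos_ne: "cos (\<phi> k - \<phi> l) < 1" if kl: "k < n" "l < n" "k \<noteq> l" for k l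
  proof -
    have "cos (\<phi> l - \<phi> k) < cos 0" if "k < l" "l < n" for k l
      using that range[of k] range[of l] mono[of k l] by (intro cos_less_cos_of_arc) auto
    moreover have "cos (\<phi> k - \<phi> l) = cos (\<phi> l - \<phi> k)" by (metis cos_minus minus_diff_eq)
    ultimately show ?thesis using kl by (metis cos_zero linorder_neqE_nat)
  qed
  have inj: "p k \<noteq> p l" if "k < n" "l < n" "k \<noteq> l" for k l
  proof
    assume "p k = p l"
    then have "h\<^sup>2 * cos (\<phi> k - \<phi> l) = h\<^sup>2 * 1" using inner_pp[of k l] inner_pp[of l l] by simp
    then show False using cos_ne[OF that] h by simp
  qed
  have dist_p: "hyp_dist (p k) (p l) = arcosh ((cosh r)\<^sup>2 - (sinh r)\<^sup>2 * cos (\<phi> k - \<phi> l))" for k l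
  proof -
    have "sqrt ((1 - (norm (p k))\<^sup>2) * (1 - (norm (p l))\<^sup>2)) = 1 - h\<^sup>2"
      using h by (simp add: norm_p abs_square_le_1)
    then have "hyp_dist (p k) (p l) = arcosh ((1 - h\<^sup>2 * cos (\<phi> k - \<phi> l)) * (cosh r)\<^sup>2)"
      by (simp add: hyp_dist_def inner_pp h2)
    also have "(1 - h\<^sup>2 * cos (\<phi> k - \<phi> l)) * (cosh r)\<^sup>2 =
        (cosh r)\<^sup>2 - ((cosh r)\<^sup>2 * h\<^sup>2) * cos (\<phi> k - \<phi> l)" by (simp add: algebra_simps)
    finally show ?thesis unfolding h2(2) .
  qed
  let ?s = "\<lambda>i. Suc i mod n"
  have s: "?s i < n" for i using n3 by simp
  have side: "hyp_dist (p i) (p (?s i)) = d ! i" if i: "i < n" for i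
  proof -
    have "cos (\<phi> i - \<phi> (?s i)) = cos (2 * t i)"
    proof (cases "Suc i = n")
      case True
      then have "\<phi> i = 2 * pi - 2 * t i" using \<phi>S[of i] \<phi>0 by simp
      then show ?thesis using True \<phi>0 by (simp add: cos_diff)
    next
      case False
      then have "\<phi> i - \<phi> (?s i) = - (2 * t i)" using \<phi>S[of i] i by simp
      then show ?thesis by (simp only: cos_minus)
    qed
    moreover have "cosh (d ! i) = (cosh r)\<^sup>2 - (sinh r)\<^sup>2 * cos (2 * t i)"
    proof -
      have "cosh (d ! i) = 1 + 2 * (sinh (d ! i / 2))\<^sup>2"
        using cosh_double[of "d ! i / 2"] cosh_square_eq[of "d ! i / 2"] by simp
      also have "sinh (d ! i / 2) = sinh r * sin (t i)"
        using half_anglesD(5)[OF t] i by (simp add: n_def)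
      finally show ?thesis
        unfolding cosh_square_eq cos_double_sin by (simp add: power_mult_distrib algebra_simps)
    qed
    ultimately have "hyp_dist (p i) (p (?s i)) = arcosh (cosh (d ! i))" by (simp add: dist_p)
    then show ?thesis using half_anglesD(3)[OF t] i by (simp add: arcosh_cosh_real n_def less_imp_le)
  qed
  have edge: "cos (\<phi> k - (\<phi> i + t i)) < cos (t i)" if i: "i < n" and k: "k < n" "k \<noteq> i" "k \<noteq> ?s i" for i k
  proof (cases "i < k")
    case True
    then have "Suc i < k" using k i by (cases "Suc i = k") auto
    then have "\<phi> (Suc i) < \<phi> k" using mono k by simp
    then show ?thesis using \<phi>S[of i] tp[OF i] tpi[OF i] range[OF i] range[OF k(1)]
      by (intro cos_less_cos_of_arc) auto
  next
    case False
    then have ki: "\<phi> k < \<phi> i" using mono[of k i] k i by simp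
    have "\<phi> i + 2 * t i \<le> 2 * pi" using \<phi>S[of i] mono[of "Suc i" n] \<phi>0 i by (cases "Suc i = n") auto
    \<comment> \<open>If both alternatives failed, side \<open>i\<close> would end at vertex 0 and
      \<open>k\<close> would be that vertex, against \<open>k \<noteq> ?s i\<close>. Strictness here
      is what keeps \<open>p k\<close> off the line.\<close>
    moreover have "\<phi> i + 2 * t i < 2 * pi \<or> 0 < \<phi> k"
      using \<phi>S[of i] mono[of "Suc i" n] mono[of 0 k] \<phi>0 i k by (cases "Suc i = n") auto
    ultimately have "cos (\<phi> k - (\<phi> i + t i) + 2 * pi) < cos (t i)"
      using ki tp[OF i] range[OF k(1)] by (intro cos_less_cos_of_arc) auto
    then show ?thesis by simp
  qed
  define ps where "ps = map p [0..<n]"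
  have len: "length ps = n" and nth: "\<And>i. i < n \<Longrightarrow> ps ! i = p i" and set: "set ps = p ` {..<n}"
    by (auto simp: ps_def)
  have "convex_polygon ps"
    unfolding convex_polygon_def len
  proof (intro conjI allI impI)
    show "3 \<le> n" by fact
    show "distinct ps" unfolding distinct_conv_nth len using inj nth by auto
    show "set ps \<subseteq> hyp_plane" using h norm_p by (auto simp: set)
    show "{x. x extreme_point_of convex hull set ps} = set ps"
    proof
      show "{x. x extreme_point_of convex hull set ps} \<subseteq> set ps"
        using extreme_point_of_convex_hull by blast
      show "set ps \<subseteq> {x. x extreme_point_of convex hull set ps}"
      proof
        fix x assume "x \<in> set ps"
        then obtain k where k: "k < n" "x = p k" by (auto simp: set)
        have "convex hull {x} face_of convex hull set ps"
        proof (rule face_of_convex_hull_supporting[where a = "p k" and b = "h\<^sup>2"])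
          fix y assume "y \<in> set ps - {x}"
          then obtain l where l: "l < n" "l \<noteq> k" "y = p l" using k by (auto simp: set)
          then show "p k \<bullet> y < h\<^sup>2" using cos_ne[of k l] k h by (simp add: inner_pp)
        qed (use k \<open>x \<in> set ps\<close> in \<open>auto simp: inner_pp\<close>)
        then show "x \<in> {x. x extreme_point_of convex hull set ps}" by (simp add: face_of_singleton)
      qed
    qed
  next
    fix i assume i: "i < n"
    let ?T = "{p i, p (?s i)}"
    have "convex hull ?T face_of convex hull set ps"
    proof (rule face_of_convex_hull_supporting[where a = "cis (\<phi> i + t i)" and b = "h * cos (t i)"])
      show "?T \<subseteq> set ps" using i s by (auto simp: set)
      have "cos (\<phi> (?s i) - (\<phi> i + t i)) = cos (t i)"
      proof (cases "Suc i = n")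
        case True
        then have eq: "\<phi> (?s i) - (\<phi> i + t i) = t i - 2 * pi" using \<phi>S[of i] \<phi>0 by simp
        show ?thesis unfolding eq by (simp add: cos_diff)
      qed (use \<phi>S[of i] i in simp)
      moreover have "cos (\<phi> i - (\<phi> i + t i)) = cos (t i)" by simp
      ultimately show "cis (\<phi> i + t i) \<bullet> x = h * cos (t i)" if "x \<in> ?T" for x
        using that by (auto simp: inner_p)
      fix x assume "x \<in> set ps - ?T"
      then obtain k where k: "k < n" "x = p k" "k \<noteq> i" "k \<noteq> ?s i" by (auto simp: set)
      show "cis (\<phi> i + t i) \<bullet> x < h * cos (t i)"
        unfolding k(2) inner_p using edge[OF i k(1,3,4)] h by simp
    qed simp
    moreover have "?s i \<noteq> i" using i n3 by (cases "Suc i = n") auto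
    then have "p i \<noteq> p (?s i)" using inj[OF i s] by metis
    ultimately show "closed_segment (ps ! i) (ps ! ?s i) edge_of convex hull set ps"
      unfolding edge_of_def segment_convex_hull using nth[OF i] nth[OF s]
      by (simp add: aff_dim_convex_hull)
  qed
  moreover have "hyp_dist 0 x = r" if x: "x \<in> set ps" for x
  proof -
    obtain k where "x = p k" using x by (auto simp: set)
    then have "hyp_dist 0 x = arcosh (1 / sqrt (1 - h\<^sup>2))" by (simp add: hyp_dist_def norm_p)
    also have "\<dots> = arcosh (cosh r)" unfolding h2 by (simp add: real_sqrt_divide)
    finally show ?thesis using r by (simp add: arcosh_cosh_real)
  qed
  ultimately have "cyclic_polygon ps r"
    unfolding cyclic_polygon_def by (intro conjI bexI[of _ 0]) auto
  moreover have "side_lengths ps = d"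
    by (rule nth_equalityI) (use side s nth in \<open>auto simp: side_lengths_def len n_def\<close>)
  ultimately show ?thesis by blast
qed

text \<open>The constructed polygon gives existence for the description operator; for uniqueness,
  any polygon with these sides yields half-angle data. From here on radii are handled without
  polygons.\<close>

lemma J_eq:
  assumes t: "half_angles d r t" and n: "length d \<ge> 3"
  shows "J d = r"
  unfolding J_def
proof (rule the_equality)
  show "\<exists>ps. cyclic_polygon ps r \<and> side_lengths ps = d"
    by (rule half_angles_cyclic_polygon[OF t n])
next
  fix r' assume "\<exists>ps. cyclic_polygon ps r' \<and> side_lengths ps = d"
  then obtain ps where ps: "cyclic_polygon ps r'" "side_lengths ps = d" by blast
  have "length ps = length d" using ps(2) by (auto simp: side_lengths_def)
  then obtain u where "half_angles d r' u"
    using cyclic_polygon_half_angles[OF ps(1)] half_anglesD(3)[OF t] ps(2) by metis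
  then show "r' = r" using half_angles_radius_unique[OF n _ t] by blast
qed

section \<open>Paths to the root of a tree\<close>

lemma walk_Cons_Cons [simp]:
  "walk G (u # v # vs) (e # es) \<longleftrightarrow>
    u \<in> verts G \<and> e \<in> edges G \<and> ends G e = {u, v} \<and> walk G (v # vs) es"
  unfolding walk_def by (auto simp: All_less_Suc2 nth_Cons split: nat.splits)

lemma walk_Nil [simp]: "walk G vs [] \<longleftrightarrow> (\<exists>v\<in>verts G. vs = [v])"
  unfolding walk_def by (auto simp: length_Suc_conv)

lemma not_walk_singleton [simp]: "\<not> walk G [v] (e # es)"
  by (simp add: walk_def)

lemma walk_Cons_edge:
  assumes "walk G vs (e # es)"
  obtains u v ws where "vs = u # v # ws" "walk G (v # ws) es"
proof -
  obtain u v ws where "vs = u # v # ws"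
    using assms unfolding walk_def by (auto simp: length_Suc_conv)
  then show ?thesis using assms that by simp
qed

lemma walk_append:
  assumes "walk G vs es" "walk G ws fs" "last vs = hd ws"
  shows "walk G (vs @ tl ws) (es @ fs)"
  using assms
proof (induction es arbitrary: vs)
  case Nil
  then obtain v where "vs = [v]" by auto
  moreover have "ws \<noteq> []" using Nil.prems by (auto simp: walk_def)
  ultimately show ?case using Nil.prems by (cases ws) auto
next
  case (Cons e es)
  then obtain u v us where vs: "vs = u # v # us" "walk G (v # us) es"
    by (meson walk_Cons_edge)
  then show ?case using Cons by fastforce
qed

lemma walk_rev:
  assumes "walk G vs es"
  shows "walk G (rev vs) (rev es)"
  using assms
proof (induction es arbitrary: vs)
  case (Cons e es)
  then obtain u v us where vs: "vs = u # v # us" "walk G (v # us) es"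
    by (meson walk_Cons_edge)
  then have "v \<in> verts G" by (auto simp: walk_def)
  then have "walk G [v, u] [e]" using vs Cons.prems by auto
  then have "walk G ((rev us @ [v]) @ tl [v, u]) (rev es @ [e])"
    using Cons.IH[OF vs(2)] by (intro walk_append) auto
  then show ?case using vs by simp
qed auto

text \<open>\<open>distinct_adj\<close> says that the walk never turns back. In a shortest
  counterexample, dropping either end vertex leaves distinct vertices, so only the two ends
  coincide. The edges are then distinct as well, and the walk is a cycle.\<close>

lemma tree_walk_distinct:
  assumes "is_tree G" "walk G vs es" "distinct_adj es"
  shows "distinct vs"
  using assms(2,3)
proof (induction "length es" arbitrary: vs es rule: less_induct)
  case less
  show ?case
  proof (rule ccontr)
    assume nd: "\<not> distinct vs"
    then have "es \<noteq> []" using less.prems by auto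
    then obtain e fs where es: "es = e # fs" by (cases es) auto
    then obtain u v us where vs: "vs = u # v # us" "walk G (v # us) fs"
      using less.prems by (meson walk_Cons_edge)
    have d: "distinct (tl vs)"
      using less.hyps[of fs "v # us"] vs es less.prems by (auto dest: distinct_adj_ConsD)
    obtain e' fs' where es': "es = fs' @ [e']" using \<open>es \<noteq> []\<close> by (metis rev_exhaust)
    have r: "walk G (rev vs) (e' # rev fs')" using walk_rev[OF less.prems(1)] es' by simp
    then obtain u' v' us' where vs': "rev vs = u' # v' # us'" "walk G (v' # us') (rev fs')"
      by (meson walk_Cons_edge)
    have "distinct (v' # us')"
      using less.hyps[of "rev fs'" "v' # us'"] vs' es' less.prems
      by (metis distinct_adj_ConsD distinct_adj_rev length_append_singleton length_rev lessI rev.simps(2) rev_rev_ident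
          append_Nil rev_append)
    moreover have "v' # us' = rev (butlast vs)"
      using vs'(1) by (metis butlast_rev list.sel(3) rev_rev_ident)
    ultimately have "distinct (butlast vs)" by simp
    then have h: "hd vs = last vs" using nd d vs
      by (metis append_butlast_last_id butlast.simps(2) distinct.simps(2) in_set_conv_decomp
          last_ConsR list.distinct(1) list.sel(1) list.sel(3) not_distinct_conv_prefix
          set_ConsD rotate1.simps(2) set_rotate1)
    have len: "length vs = Suc (length es)" using less.prems by (simp add: walk_def)
    \<comment> \<open>An edge used twice would be traversed in opposite directions, since the
      vertices entered differ. That makes \<open>vs ! Suc a = vs ! b\<close>, so the two uses are
      adjacent, against \<open>distinct_adj\<close>.\<close>
    have neq: "es ! a \<noteq> es ! b" if ab: "a < b" "b < length es" for a b
    proof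
      assume eq: "es ! a = es ! b"
      have "{vs ! a, vs ! Suc a} = {vs ! b, vs ! Suc b}"
        using eq ab less.prems unfolding walk_def by (metis order_less_trans)
      moreover have "vs ! Suc a \<noteq> vs ! Suc b"
        using d ab len by (simp add: distinct_conv_nth nth_tl)
      ultimately have "vs ! Suc a = vs ! b" by blast
      then have "tl vs ! a = tl vs ! (b - 1)" using ab len by (simp add: nth_tl)
      then have "a = b - 1" using d ab len by (simp add: nth_eq_iff_index_eq)
      then have "b = Suc a" using ab by simp
      then show False using less.prems(2) eq ab by (simp add: distinct_adj_conv_nth)
    qed
    have "distinct es" unfolding distinct_conv_nth
      using neq by (metis linorder_neqE_nat)
    then show False using assms(1) less.prems(1) \<open>es \<noteq> []\<close> h d unfolding is_tree_def by blast
  qed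
qed

lemma walk_distinct_adj:
  assumes "walk G vs es" "distinct vs"
  shows "distinct_adj es"
  using assms
proof (induction es arbitrary: vs)
  case (Cons e es)
  then obtain u v us where vs: "vs = u # v # us" "walk G (v # us) es"
    by (meson walk_Cons_edge)
  have "e \<noteq> f" if es: "es = f # fs" for f fs
  proof -
    obtain w ws where us: "us = w # ws" using vs(2) es by (cases us) auto
    have "ends G e = {u, v}" "ends G f = {v, w}" "u \<noteq> w" using vs Cons.prems es us by auto
    then show ?thesis by (metis doubleton_eq_iff)
  qed
  then show ?case using Cons vs by (cases es) auto
qed simp

text \<open>A walk is shortened from its far end: prepending an edge to a path either creates a
  backtrack, which cancels, or keeps the walk reduced and hence a path.\<close>

lemma tree_root_path:
  assumes "is_tree G" "v \<in> verts G" "x \<in> verts G"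
  obtains vs es where "walk G vs es" "distinct vs" "hd vs = v" "last vs = x"
proof -
  obtain vs es where "walk G vs es" "hd vs = v" "last vs = x"
    using assms unfolding is_tree_def by blast
  then have "\<exists>vs es. walk G vs es \<and> distinct vs \<and> hd vs = v \<and> last vs = x"
  proof (induction es arbitrary: vs v)
    case Nil
    then show ?case by (intro exI[of _ vs] exI[of _ "[]"]) auto
  next
    case (Cons e es)
    then obtain v' us where vs: "vs = v # v' # us" "walk G (v' # us) es"
      by (metis list.sel(1) walk_Cons_edge)
    then obtain ws fs where w: "walk G ws fs" "distinct ws" "hd ws = v'" "last ws = x"
      using Cons.IH[of "v' # us" v'] Cons.prems by auto
    have e: "v \<in> verts G" "e \<in> edges G" "ends G e = {v, v'}" using Cons.prems vs by auto
    have ne: "ws \<noteq> []" using w(1) by (auto simp: walk_def)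
    show ?case
    proof (cases "fs \<noteq> [] \<and> hd fs = e")
      case True
      then obtain fs' where fs: "fs = e # fs'" by (cases fs) auto
      then obtain y ys where ws: "ws = v' # y # ys" "walk G (y # ys) fs'"
        using w by (metis list.sel(1) walk_Cons_edge)
      have "y = v" using w(1) e ws fs w(2) by (auto simp: doubleton_eq_iff)
      then show ?thesis using ws w by (intro exI[of _ "y # ys"] exI[of _ fs']) auto
    next
      case False
      have 1: "walk G (v # ws) (e # fs)" using w e ne by (cases ws) auto
      have "distinct_adj (e # fs)" using False walk_distinct_adj[OF w(1,2)] by (cases fs) auto
      then have "distinct (v # ws)" using tree_walk_distinct[OF assms(1) 1] by blast
      then show ?thesis using 1 w ne by (intro exI[of _ "v # ws"] exI[of _ "e # fs"]) auto
    qed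
  qed
  then show ?thesis using that by blast
qed

text \<open>If the first edges differ, one path reversed and followed by the other never turns back,
  so its vertices are distinct; yet it starts and ends at the common last vertex.\<close>

lemma tree_first_edge_unique:
  assumes "is_tree G" and 1: "walk G vs (e # es)" "distinct vs"
    and 2: "walk G ws (f # fs)" "distinct ws" and "hd vs = hd ws" "last vs = last ws"
  shows "e = f"
proof (rule ccontr)
  assume "e \<noteq> f"
  have w: "walk G (rev vs @ tl ws) (rev (e # es) @ f # fs)"
    using 1 2 assms(6) by (intro walk_append walk_rev) (auto simp: last_rev assms)
  have "distinct_adj (rev (e # es) @ f # fs)"
    using \<open>e \<noteq> f\<close> walk_distinct_adj[OF 1] walk_distinct_adj[OF 2]
    by (simp only: distinct_adj_append_iff distinct_adj_rev) (auto simp: last_rev)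
  then have d: "distinct (rev vs @ tl ws)" using tree_walk_distinct[OF assms(1) w] by blast
  obtain u v us where vs: "vs = u # v # us" using 1 by (meson walk_Cons_edge)
  obtain u' v' us' where ws: "ws = u' # v' # us'" using 2 by (meson walk_Cons_edge)
  have "last vs \<in> set (rev vs)" using vs by (metis last_in_set list.distinct(1) set_rev)
  moreover have "last ws \<in> set (tl ws)" using ws by auto
  ultimately show False using d assms(7) by auto
qed

lemma root_edge_eq:
  assumes "is_tree T" "walk T vs (e # es)" "distinct vs" "last vs = x"
  shows "root_edge T x (hd vs) = e"
  unfolding root_edge_def
proof (rule the_equality)
  show "\<exists>ws fs. walk T ws (e # fs) \<and> distinct ws \<and> hd ws = hd vs \<and> last ws = x"
    using assms by blast
next
  fix f assume "\<exists>ws fs. walk T ws (f # fs) \<and> distinct ws \<and> hd ws = hd vs \<and> last ws = x"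
  then show "f = e" using tree_first_edge_unique[OF assms(1)] assms by metis
qed

lemma tree_path_extend:
  assumes "is_tree T" "walk T vs es" "distinct vs" "hd vs = v"
    and "e \<in> edges T" "ends T e = {u, v}" "u \<in> verts T" "es \<noteq> [] \<Longrightarrow> hd es \<noteq> e"
  shows "walk T (u # vs) (e # es)" "distinct (u # vs)"
proof -
  have "vs \<noteq> []" using assms(2) by (auto simp: walk_def)
  then show 1: "walk T (u # vs) (e # es)" using assms by (cases vs) auto
  have "distinct_adj (e # es)" using assms(8) walk_distinct_adj[OF assms(2,3)] by (cases es) auto
  then show "distinct (u # vs)" using tree_walk_distinct[OF assms(1) 1] by blast
qed

section \<open>Edges at a vertex, and positivity of their lengths\<close>

lemma set_edge_order:
  assumes "cyclic_edge_orders V ord" "v \<in> verts V"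
  shows "set (ord v) = {e \<in> edges V. v \<in> ends V e}"
proof -
  have "e \<in> set (ord v) \<longleftrightarrow> edge_mult V v e \<noteq> 0" for e
    using assms unfolding cyclic_edge_orders_def by (metis count_list_0_iff)
  then show ?thesis by (auto simp: edge_mult_def split: if_splits)
qed

lemma length_edge_order:
  assumes "cyclic_edge_orders V ord" "v \<in> verts V" "finite (edges V)"
  shows "length (ord v) = valence V v"
proof -
  have "valence V v = (\<Sum>e\<in>edges V. count_list (ord v) e)"
    using assms by (simp add: valence_def cyclic_edge_orders_def)
  also have "\<dots> = length (ord v)"
    using assms set_edge_order[OF assms(1,2)] by (intro sum_count_set) auto
  finally show ?thesis by simp
qed

text \<open>Even a loop fills only two places in the cyclic order, so valence three leaves room for
  another edge.\<close>

lemma edge_order_other: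
  assumes "cyclic_edge_orders V ord" "v \<in> verts V" "finite (edges V)" "valence V v \<ge> 3"
  obtains f where "f \<in> set (ord v)" "f \<noteq> e"
proof -
  have "\<not> set (ord v) \<subseteq> {e}"
  proof
    assume "set (ord v) \<subseteq> {e}"
    then have "count_list (ord v) e = length (ord v)"
      using sum_count_set[of "ord v" "{e}"] by simp
    moreover have "count_list (ord v) e \<le> 2"
      using assms by (auto simp: cyclic_edge_orders_def edge_mult_def)
    ultimately show False using assms length_edge_order[OF assms(1-3)] by simp
  qed
  then show ?thesis using that by blast
qed

lemma finite_graph_ends:
  assumes "finite_graph G" "e \<in> edges G" "v \<in> ends G e"
  obtains u where "u \<in> verts G" "ends G e = {u, v}"
proof -
  have E: "ends G e \<subseteq> verts G" "card (ends G e) = 1 \<or> card (ends G e) = 2"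
    using assms unfolding finite_graph_def by auto
  from E(2) obtain x y where "ends G e = {x, y}" by (metis card_1_singletonE card_2_iff insert_absorb2)
  then show ?thesis using E(1) assms(3) that by (auto simp: insert_commute)
qed

context
  fixes V T :: "('v, 'e) multigraph" and vT :: 'v and ord :: "'v \<Rightarrow> 'e list" and d :: "'e \<Rightarrow> real"
  assumes V: "finite_graph V" and T: "finite_graph T" and sub: "subgraph T V" and tree: "is_tree T"
    and vT: "vT \<in> verts T" and val: "\<And>v. v \<in> verts V \<Longrightarrow> valence V v \<ge> 3"
    and ord: "cyclic_edge_orders V ord"
begin

lemma tree_edge_in_order:
  assumes "v \<in> verts T" "e \<in> edges T" "v \<in> ends T e"
  shows "e \<in> set (ord v)"
  using assms sub set_edge_order[OF ord] by (auto simp: subgraph_def)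

lemma order_edge_cases:
  assumes "v \<in> verts T" "e \<in> set (ord v)"
  obtains "(e, v) \<in> frontier_pairs V T" | "e \<in> edges T" "v \<in> ends T e"
proof -
  have "v \<in> verts V" using assms(1) sub by (auto simp: subgraph_def)
  then have "e \<in> edges V" "v \<in> ends V e" using assms(2) set_edge_order[OF ord] by auto
  then show ?thesis
    using assms(1) sub that by (cases "e \<in> edges T") (auto simp: subgraph_def frontier_pairs_def)
qed

text \<open>Induction away from the root: \<open>e\<close> is at least as long as some other edge at its far end,
  which is a frontier edge or lies on a longer path to the root.\<close>

lemma path_edge_pos:
  assumes front: "\<forall>(e, v)\<in>frontier_pairs V T. 0 < d e"
    and max: "\<forall>v\<in>verts T - {vT}. \<forall>e\<in>set (ord v). d e \<le> d (root_edge T vT v)"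
    and path: "walk T vs (e # es)" "distinct vs" "last vs = vT"
  shows "0 < d e"
  using path
proof (induction "card (verts T) - length vs" arbitrary: vs e es rule: less_induct)
  case less
  obtain v w ws where vs: "vs = v # w # ws" using less.prems(1) by (meson walk_Cons_edge)
  then have "vT \<in> set (w # ws)"
    using less.prems(3) by (metis last_ConsR last_in_set list.distinct(1))
  then have v: "v \<in> verts T" "v \<noteq> vT" "v \<in> verts V"
    using less.prems(1,2) vs sub by (auto simp: subgraph_def)
  obtain f where f: "f \<in> set (ord v)" "f \<noteq> e"
    using edge_order_other[OF ord v(3)] V val[OF v(3)] by (auto simp: finite_graph_def)
  have "root_edge T vT v = e" using root_edge_eq[OF tree less.prems] vs by simp
  then have "d f \<le> d e" using max[rule_format, of v f] v f by simp
  moreover have "0 < d f"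
    using v(1) f(1)
  proof (cases rule: order_edge_cases)
    case 1
    then show ?thesis using front by blast
  next
    case 2
    obtain u where u: "u \<in> verts T" "ends T f = {u, v}" by (rule finite_graph_ends[OF T 2])
    have "walk T (u # vs) (f # e # es)" "distinct (u # vs)"
      using tree_path_extend[OF tree less.prems(1,2) _ 2(1) u(2,1)] f(2) vs by auto
    moreover from this have "length (u # vs) \<le> card (verts T)"
      using T by (metis card_mono distinct_card finite_graph_def walk_def)
    ultimately show ?thesis using less.hyps[of "u # vs" f "e # es"] less.prems(3) vs by auto
  qed
  ultimately show ?case by simp
qed

text \<open>A tree edge starts a path to the root from one of its ends: either the path from
  \<open>v\<close> begins with it, or prepending it to that path gives a path from the other
  end.\<close>

lemma order_edge_pos:
  assumes front: "\<forall>(e, v)\<in>frontier_pairs V T. 0 < d e"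
    and max: "\<forall>v\<in>verts T - {vT}. \<forall>e\<in>set (ord v). d e \<le> d (root_edge T vT v)"
    and v: "v \<in> verts T" and e: "e \<in> set (ord v)"
  shows "0 < d e"
  using v e
proof (cases rule: order_edge_cases)
  case 1
  then show ?thesis using front by blast
next
  case 2
  obtain u where u: "u \<in> verts T" "ends T e = {u, v}" by (rule finite_graph_ends[OF T 2])
  obtain vs es where p: "walk T vs es" "distinct vs" "hd vs = v" "last vs = vT"
    by (rule tree_root_path[OF tree v vT])
  show ?thesis
  proof (cases "es \<noteq> [] \<and> hd es = e")
    case True
    then have "walk T vs (e # tl es)" using p(1) by (cases es) auto
    then show ?thesis using path_edge_pos[OF front max] p by blast
  next
    case False
    then have "walk T (u # vs) (e # es)" "distinct (u # vs)"
      using tree_path_extend[OF tree p(1-3) 2(1) u(2,1)] by auto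
    moreover have "last (u # vs) = vT" using p by (cases vs) (auto simp: walk_def)
    ultimately show ?thesis using path_edge_pos[OF front max] by blast
  qed
qed

lemma root_edge_in_order:
  assumes "v \<in> verts T - {vT}"
  shows "root_edge T vT v \<in> set (ord v)"
proof -
  obtain vs es where p: "walk T vs es" "distinct vs" "hd vs = v" "last vs = vT"
    using tree_root_path[OF tree _ vT] assms by blast
  then obtain e fs where es: "es = e # fs" using assms by (cases es) auto
  obtain w ws where vs: "vs = v # w # ws" using p es by (metis list.sel(1) walk_Cons_edge)
  have "root_edge T vT v = e" using root_edge_eq[OF tree _ p(2,4)] p(1,3) es by blast
  moreover have "e \<in> edges T" "v \<in> ends T e" using p(1) es vs by auto
  ultimately show ?thesis using assms tree_edge_in_order[of v e] by simp
qed

lemma radius_le_root: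
  fixes h :: "'v \<Rightarrow> real"
  assumes h: "\<And>v w. \<lbrakk>v \<in> verts T; w \<in> children T vT v\<rbrakk> \<Longrightarrow> h w < h v" and v: "v \<in> verts T"
  shows "h v \<le> h vT"
proof -
  have "h (hd vs) \<le> h vT" if "walk T vs es" "distinct vs" "last vs = vT" for vs es
    using that
  proof (induction es arbitrary: vs)
    case Nil
    then show ?case by auto
  next
    case (Cons e es)
    then obtain u w ws where vs: "vs = u # w # ws" "walk T (w # ws) es"
      by (meson walk_Cons_edge)
    have "root_edge T vT u = e" using root_edge_eq[OF tree Cons.prems] vs by simp
    moreover have "vT \<in> set (w # ws)"
      using Cons.prems(3) vs(1) by (metis last_ConsR last_in_set list.distinct(1))
    ultimately have "u \<in> children T vT w"
      using Cons.prems(1,2) vs by (auto simp: children_def)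
    moreover have "w \<in> verts T" using vs(2) by (auto simp: walk_def)
    moreover have "h w \<le> h vT" using Cons.IH[OF vs(2)] Cons.prems vs by simp
    ultimately show ?case using h[of w u] vs by simp
  qed
  moreover obtain vs es where "walk T vs es" "distinct vs" "hd vs = v" "last vs = vT"
    by (rule tree_root_path[OF tree v vT])
  ultimately show ?thesis by blast
qed

end

section \<open>Passing to the closure of \<open>Ad\<close>\<close>

text \<open>With finitely many edges, a product of balls of radius \<open>1 / Suc k\<close> is open
  in the product topology, so sequences suffice to reach the closure.\<close>

lemma Ad_closure_sequence:
  assumes "finite (edges T)" "dE \<in> Ad_closure V T vT ord dF"
  obtains D where "\<And>k. D k \<in> Ad V T vT ord dF" "\<And>e. e \<in> edges T \<Longrightarrow> (\<lambda>k. D k e) \<longlonglongrightarrow> dE e"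
proof -
  have "\<exists>y. y \<in> Ad V T vT ord dF \<and> (\<forall>e\<in>edges T. dist (y e) (dE e) < inverse (real (Suc k)))" for k
  proof -
    let ?U = "PiE (edges T) (\<lambda>e. ball (dE e) (inverse (real (Suc k))))"
    have "openin (powertop_real (edges T)) ?U"
      using assms(1) by (simp add: openin_PiE del: of_nat_Suc inverse_Suc)
    moreover have "dE \<in> topspace (powertop_real (edges T))"
      using assms(2) by (auto simp: Ad_closure_def in_closure_of)
    then have "dE \<in> ?U" by (auto simp: PiE_iff)
    ultimately obtain y where "y \<in> Ad V T vT ord dF" "y \<in> ?U"
      using assms(2) unfolding Ad_closure_def in_closure_of by blast
    then show ?thesis by (intro exI[of _ y]) (auto simp: PiE_iff dist_commute)
  qed
  then obtain D where D: "\<And>k. D k \<in> Ad V T vT ord dF"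
    "\<And>k e. e \<in> edges T \<Longrightarrow> dist (D k e) (dE e) < inverse (real (Suc k))" by metis
  have "(\<lambda>k. D k e) \<longlonglongrightarrow> dE e" if "e \<in> edges T" for e
    by (rule metric_tendsto_imp_tendsto[OF LIMSEQ_inverse_real_of_nat])
      (use D(2)[OF that] in \<open>auto simp: dist_real_def less_imp_le intro!: always_eventually\<close>)
  then show ?thesis using that D(1) by blast
qed

theorem lemma5p7:
  fixes V T :: "('v, 'e) multigraph"
    and vT :: 'v
    and ord :: "'v \<Rightarrow> 'e list"
    and dF dE d :: "'e \<Rightarrow> real"
  assumes "finite_graph V" and "finite_graph T" and "subgraph T V"
    and "is_tree T" and "vT \<in> verts T"
    and "\<And>v. v \<in> verts V \<Longrightarrow> valence V v \<ge> 3"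
    and "cyclic_edge_orders V ord"
    and "\<And>e v. (e, v) \<in> frontier_pairs V T \<Longrightarrow> dF e > 0"
    and "Ad V T vT ord dF \<noteq> {}"
    and "dE \<in> Ad_closure V T vT ord dF"
    and "d = override_on dF dE (edges T)"
  shows "(\<forall>v\<in>verts T - {vT}. P ord d v \<in> AC (valence V v) - Cent (valence V v) \<and>
            d (root_edge T vT v) = Max (set (P ord d v))) \<and>
         P ord d vT \<in> Cent (valence V vT) \<union> BC (valence V vT) \<and>
         (\<forall>v\<in>verts T. \<forall>w\<in>children T vT v. J (P ord d v) \<ge> J (P ord d w))"
proof -
  note graph = assms(1-7)
  have fin: "finite (edges V)" "finite (edges T)" using assms(1,2) by (auto simp: finite_graph_def)
  have TV: "v \<in> verts V" if "v \<in> verts T" for v using assms(3) that by (auto simp: subgraph_def)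
  obtain D0 where D0: "\<And>k. D0 k \<in> Ad V T vT ord dF" "\<And>e. e \<in> edges T \<Longrightarrow> (\<lambda>k. D0 k e) \<longlonglongrightarrow> dE e"
    using Ad_closure_sequence[OF fin(2) assms(10)] by blast
  define D where "D k = override_on dF (D0 k) (edges T)" for k :: nat
  have D: "v \<in> verts T - {vT} \<Longrightarrow> P ord (D k) v \<in> AC (valence V v) - Cent (valence V v)"
    "v \<in> verts T - {vT} \<Longrightarrow> D k (root_edge T vT v) = Max (set (P ord (D k) v))"
    "P ord (D k) vT \<in> Cent (valence V vT)"
    "\<lbrakk>v \<in> verts T; w \<in> children T vT v\<rbrakk> \<Longrightarrow> J (P ord (D k) w) < J (P ord (D k) v)" for k v w
    using D0(1)[of k] unfolding Ad_def Let_def D_def by blast+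
  have lim: "(\<lambda>k. D k e) \<longlonglongrightarrow> d e" for e
    using D0(2)[of e] by (cases "e \<in> edges T") (simp_all add: D_def assms(11))
  \<comment> \<open>This weak inequality survives the limit without any knowledge of radii; the
    positivity of the limiting lengths rests on it.\<close>
  have max: "\<forall>v\<in>verts T - {vT}. \<forall>e\<in>set (ord v). d e \<le> d (root_edge T vT v)"
    using D(2) by (intro ballI LIMSEQ_le[OF lim lim]) (auto simp: P_def)
  have front: "\<forall>(e, v)\<in>frontier_pairs V T. 0 < d e"
    using assms(8) by (auto simp: assms(11) frontier_pairs_def)
  have pos: "0 < d e" if "v \<in> verts T" "e \<in> set (ord v)" for v e
    by (rule order_edge_pos[OF graph front max that])
  have len: "length (P ord x v) = valence V v" "length (P ord x v) \<ge> 3" if "v \<in> verts T" for x :: "'e \<Rightarrow> real" and v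
    using length_edge_order[OF assms(7) TV[OF that] fin(1)] assms(6)[OF TV[OF that]] by (auto simp: P_def)
  have nth: "P ord x v ! j = x (ord v ! j)" if "j < valence V v" "v \<in> verts T" for x :: "'e \<Rightarrow> real" and v j
    using that len[OF that(2), of x] by (simp add: P_def)
  have inord: "ord v ! j \<in> set (ord v)" if "j < valence V v" "v \<in> verts T" for v j
    using that len[OF that(2), of d] by (simp add: P_def)
  have "\<exists>t. half_angles (P ord (D k) v) (J (P ord (D k) v)) t" if v: "v \<in> verts T" for k v
  proof -
    \<comment> \<open>At the root the definition of \<open>Ad\<close> supplies only
      \<open>Cent\<close>, elsewhere only the \<open>AC\<close> part is of use; half angles exist in
      either case.\<close>
    have "P ord (D k) v \<in> AC (valence V v) \<union> Cent (valence V v)"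
      using D(1)[of v k] D(3)[of k] v by (cases "v = vT") auto
    then obtain r t where "half_angles (P ord (D k) v) r t"
      using half_angles_exist[OF len(2)[OF v]] len(1)[OF v] by metis
    then show ?thesis using J_eq[OF _ len(2)[OF v]] by metis
  qed
  then have "\<forall>k v. \<exists>t. v \<in> verts T \<longrightarrow> half_angles (P ord (D k) v) (J (P ord (D k) v)) t"
    by blast
  then obtain t where t: "\<And>k v. v \<in> verts T \<Longrightarrow> half_angles (P ord (D k) v) (J (P ord (D k) v)) (t k v)"
    by metis
  have "\<exists>B. \<forall>k. D k e \<le> B" for e
    using convergent_imp_Bseq[OF convergentI[OF lim[of e]]] by (metis Bseq_def abs_le_D1 real_norm_def)
  then obtain M where M: "\<And>e k. D k e \<le> M e" by metis
  obtain B where B: "\<And>k v. v \<in> verts T \<Longrightarrow> J (P ord (D k) v) \<le> B"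
  proof
    fix k v assume v: "v \<in> verts T"
    let ?n = "valence V vT" and ?M = "Max (M ` set (ord vT))"
    have "J (P ord (D k) v) \<le> J (P ord (D k) vT)"
      by (rule radius_le_root[OF graph D(4) v])
    also have "\<dots> \<le> arsinh (sinh (?M / 2) / sin (pi / ?n))"
    proof (rule half_angles_radius_bound[OF t[OF assms(5)] len(2)[OF assms(5)], unfolded len(1)[OF assms(5)]])
      fix j assume j: "j < ?n"
      show "t k vT j \<le> pi / 2"
        using half_angles_Cent_iff[OF len(2)[OF assms(5)] t[OF assms(5)]] D(3)[of k] j
          len(1)[OF assms(5)] by (metis less_imp_le)
      have "M (ord vT ! j) \<le> ?M" using inord[OF j assms(5)] by (intro Max_ge) auto
      then show "P ord (D k) vT ! j \<le> ?M" using nth[OF j assms(5)] M order_trans by metis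
    qed
    finally show "J (P ord (D k) v) \<le> arsinh (sinh (?M / 2) / sin (pi / ?n))" .
  qed
  \<comment> \<open>The extraction starts from a given subsequence \<open>\<tau>\<close>, so that it
    can be repeated for a second vertex and two radii can be compared along a common
    subsequence.\<close>
  have limit: "\<exists>\<sigma> \<rho> u. strict_mono \<sigma> \<and> (\<lambda>k. J (P ord (D (\<tau> (\<sigma> k))) v)) \<longlonglongrightarrow> \<rho> \<and>
      half_angles (P ord d v) \<rho> u \<and> (\<forall>j<valence V v. (\<lambda>k. t (\<tau> (\<sigma> k)) v j) \<longlonglongrightarrow> u j)"
    if v: "v \<in> verts T" and \<tau>: "strict_mono \<tau>" for v and \<tau> :: "nat \<Rightarrow> nat"
  proof -
    have P: "(\<lambda>k. P ord (D (\<tau> k)) v ! j) \<longlonglongrightarrow> P ord d v ! j" if "j < length (P ord d v)" for j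
      using that nth[of j v] len(1)[OF v] v LIMSEQ_subseq_LIMSEQ[OF lim \<tau>] by (simp add: o_def)
    have Ppos: "0 < P ord d v ! j" if "j < length (P ord d v)" for j
      using that nth[of j v d] len(1)[OF v] v pos[OF v inord] by simp
    obtain \<sigma> \<rho> u where "strict_mono \<sigma>" "(\<lambda>k. J (P ord (D (\<tau> (\<sigma> k))) v)) \<longlonglongrightarrow> \<rho>"
      "half_angles (P ord d v) \<rho> u" "\<And>j. j < length (P ord d v) \<Longrightarrow> (\<lambda>k. t (\<tau> (\<sigma> k)) v j) \<longlonglongrightarrow> u j"
      by (rule half_angles_limit[OF _ P Ppos len(2)[OF v] t[OF v] B[OF v]]) (simp add: len(1)[OF v], assumption, assumption, rule that)
    then show ?thesis using len(1)[OF v] by metis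
  qed
  have nonroot: "P ord d v \<in> AC (valence V v) - Cent (valence V v)" if v: "v \<in> verts T - {vT}" for v
  proof -
    have vt: "v \<in> verts T" using v by simp
    obtain \<sigma> \<rho> u where u: "half_angles (P ord d v) \<rho> u"
      "\<And>j. j < valence V v \<Longrightarrow> (\<lambda>k. t (\<sigma> k) v j) \<longlonglongrightarrow> u j"
      using limit[OF vt strict_mono_id] by auto
    have "P ord d v \<notin> Cent (valence V v)"
    proof
      assume "P ord d v \<in> Cent (valence V v)"
      then have "\<forall>j<valence V v. u j < pi / 2"
        using half_angles_Cent_iff[OF len(2)[OF vt] u(1)] len(1)[OF vt] by simp
      then have "\<forall>\<^sub>F k in sequentially. \<forall>j\<in>{..<valence V v}. t (\<sigma> k) v j < pi / 2"
        by (intro eventually_ball_finite ballI order_tendstoD(2)[OF u(2)]) simp_all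
      then obtain k where "\<forall>j\<in>{..<valence V v}. t (\<sigma> k) v j < pi / 2"
        using eventually_happens'[OF sequentially_bot] by blast
      then have "P ord (D (\<sigma> k)) v \<in> Cent (valence V v)"
        using half_angles_Cent_iff[OF len(2)[OF vt] t[OF vt]] len(1)[OF vt] by simp
      then show False using D(1)[OF v] by blast
    qed
    then show ?thesis
      using half_angles_imp_AC[OF u(1) len(2)[OF vt]] len(1)[OF vt] by simp
  qed
  moreover have "d (root_edge T vT v) = Max (set (P ord d v))" if v: "v \<in> verts T - {vT}" for v
    using max v root_edge_in_order[OF graph v]
    by (intro Max_eqI[symmetric]) (auto simp: P_def)
  moreover have "P ord d vT \<in> Cent (valence V vT) \<union> BC (valence V vT)"
  proof -
    obtain \<sigma> \<rho> u where u: "half_angles (P ord d vT) \<rho> u"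
      "\<And>j. j < valence V vT \<Longrightarrow> (\<lambda>k. t (\<sigma> k) vT j) \<longlonglongrightarrow> u j"
      using limit[OF assms(5) strict_mono_id] by auto
    \<comment> \<open>Acute angles may become right in the limit; that is exactly how
      \<open>BC\<close> enters.\<close>
    have "u j \<le> pi / 2" if "j < valence V vT" for j
    proof (rule LIMSEQ_le_const2[OF u(2)[OF that]])
      show "\<exists>N. \<forall>k\<ge>N. t (\<sigma> k) vT j \<le> pi / 2"
        using half_angles_Cent_iff[OF len(2)[OF assms(5)] t[OF assms(5)]] D(3) that
          len(1)[OF assms(5)] by (metis less_imp_le)
    qed
    then show ?thesis
      using half_angles_Cent_BC[OF len(2)[OF assms(5)] u(1)] len(1)[OF assms(5)] by simp
  qed
  moreover have "J (P ord d w) \<le> J (P ord d v)" if v: "v \<in> verts T" and w: "w \<in> children T vT v" for v w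
  proof -
    have wt: "w \<in> verts T" using w by (auto simp: children_def)
    obtain \<sigma> \<rho> u where \<sigma>: "strict_mono \<sigma>" "(\<lambda>k. J (P ord (D (\<sigma> k)) v)) \<longlonglongrightarrow> \<rho>"
      "half_angles (P ord d v) \<rho> u"
      using limit[OF v strict_mono_id] by auto
    obtain \<tau> \<rho>' u' where \<tau>: "strict_mono \<tau>" "(\<lambda>k. J (P ord (D (\<sigma> (\<tau> k))) w)) \<longlonglongrightarrow> \<rho>'"
      "half_angles (P ord d w) \<rho>' u'"
      using limit[OF wt \<sigma>(1)] by auto
    have "(\<lambda>k. J (P ord (D (\<sigma> (\<tau> k))) v)) \<longlonglongrightarrow> \<rho>"
      using LIMSEQ_subseq_LIMSEQ[OF \<sigma>(2) \<tau>(1)] by (simp add: o_def)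
    then have "\<rho>' \<le> \<rho>"
      using D(4)[OF v w] by (intro LIMSEQ_le[OF \<tau>(2)]) (auto intro: less_imp_le)
    then show ?thesis using J_eq[OF \<sigma>(3) len(2)[OF v]] J_eq[OF \<tau>(3) len(2)[OF wt]] by simp
  qed
  ultimately show ?thesis by blast
qed

end
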